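(* Let $({\bf M},F)$ be a Berwald structure and let $\nabla^b$ be its linear Berwald connection on $\pi^*{\bf TM}\to{\bf N}$. Let $h$ be any Riemannian metric on ${\bf M}$ such that $\nabla^b\,\pi^*h=0$. Then the Levi-Civita connection $\nabla^h$ of $h$ leaves the indicatrix of $F$ invariant under horizontal parallel transport.
   Context: ${\bf M}$ is an $n$-dimensional smooth manifold, ${\bf N}={\bf TM}\setminus\{0\}$ is the slit tangent bundle, $\pi:{\bf N}\to{\bf M}$ the projection, $(x^i,y^i)$ natural coordinates on ${\bf TM}$ induced by coordinates $x^i$ on ${\bf M}$. A Finsler structure on ${\bf M}$ is a function $F:{\bf TM}\to[0,\infty)$, smooth on ${\bf N}$, with $F(x,\lambda y)=\lambda F(x,y)$ for $\lambda>0$, and such that $g_{ij}(x,y)=\frac12\frac{\partial^2F^2}{\partial y^i\partial y^j}$ is positive definite on ${\bf N}$. Put $A_{ijk}=\frac F2\frac{\partial g_{ij}}{\partial y^k}$, $A^i_{jk}=g^{il}A_{ljk}$, $\gamma^i_{jk}=\frac12g^{is}\left(\frac{\partial g_{sj}}{\partial x^k}-\frac{\partial g_{jk}}{\partial x^s}+\frac{\partial g_{sk}}{\partial x^j}\right)$, and $N^i_j=\gamma^i_{jk}y^k-A^i_{jk}\gamma^k_{rs}\frac{y^ry^s}{F}$ (equivalently $N^i_j=\frac12\frac{\partial}{\partial y^j}(\gamma^i_{sk}y^sy^k)$). Set $\delta y^i=dy^i+N^i_jdx^j$. $\pi^*{\bf TM}\to{\bf N}$ is the pull-back bundle. A linear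 connection on it is given locally by 1-forms $\omega^i_j$ on ${\bf N}$, $\nabla(\pi^*\partial_j)=\omega^i_j\,\pi^*\partial_i$. The Chern connection $\nabla^{ch}$ is the unique linear connection on $\pi^*{\bf TM}$ with $dx^j\wedge\omega^i_j=0$ and $dg_{ij}-g_{kj}\omega^k_i-g_{ik}\omega^k_j=2A_{ijk}\frac{\delta y^k}{F}$; then $\omega^i_j=\Gamma^i_{jk}(x,y)dx^k$. The linear Berwald connection $\nabla^b$ is the linear connection with $\omega^i_j=\frac{\partial N^i_j}{\partial y^k}dx^k$. $({\bf M},F)$ is a Berwald structure (Berwald space) if the Chern connection coefficients $\Gamma^i_{jk}$ in natural coordinates depend only on $x$ (they "live on ${\bf M}$"). For a Riemannian metric $h=h_{ij}(x)dx^i\otimes dx^j$ on ${\bf M}$, $\pi^*h=h_{ij}(x)\,\pi^*dx^i\otimes\pi^*dx^j$ is the induced fibre metric on $\pi^*{\bf TM}$. The indicatrix at $x$ is ${\bf I}_x=\{y\in{\bf T}_x{\bf M}: F(x,y)=1\}$. That $\nabla^h$ leaves the indicatrix invariant under horizontal parallel transport means: for every path $\gamma$ in ${\bf M}$ from $x$ to $z$, parallel transport of $\nabla^h$ along $\gamma$ (equivalently, following the horizontal lifts of $\gamma$ to ${\bf N}$ determined by $\nabla^h$) maps ${\bf I}_x$ onto ${\bf I}_z$. *)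

theory Defs
  imports "HOL-Analysis.Analysis"
begin

section \<open>Smooth functions and partial derivatives\<close>

text \<open>On an open set \<open>S\<close> of a Euclidean space, \<open>Ck_on k S f\<close> is the usual notion of a \<open>C\<^sup>k\<close>
  function, by recursion on the directional derivatives.\<close>

primrec Ck_on :: "nat \<Rightarrow> 'e::euclidean_space set \<Rightarrow> ('e \<Rightarrow> 'f::real_normed_vector) \<Rightarrow> bool" where
  "Ck_on 0 S f \<longleftrightarrow> continuous_on S f"
| "Ck_on (Suc k) S f \<longleftrightarrow>
     (\<forall>x\<in>S. f differentiable (at x)) \<and> (\<forall>v. Ck_on k S (\<lambda>x. frechet_derivative f (at x) v))"

definition smooth_on :: "'e::euclidean_space set \<Rightarrow> ('e \<Rightarrow> 'f::real_normed_vector) \<Rightarrow> bool" where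
  "smooth_on S f \<longleftrightarrow> (\<forall>k. Ck_on k S f)"

definition partial :: "'n::finite \<Rightarrow> (real^'n \<Rightarrow> real) \<Rightarrow> real^'n \<Rightarrow> real" where
  "partial i f x = deriv (\<lambda>t. f (x + t *\<^sub>R axis i 1)) 0"


section \<open>Smooth manifolds and their tangent bundle\<close>

text \<open>A chart is a pair of its domain and its coordinate map; only the values of the coordinate
  map on the domain matter.\<close>

type_synonym ('a, 'n) chart = "'a set \<times> ('a \<Rightarrow> real^'n)"

abbreviation cdom :: "('a, 'n) chart \<Rightarrow> 'a set" where "cdom \<equiv> fst"
abbreviation cmap :: "('a, 'n) chart \<Rightarrow> 'a \<Rightarrow> real^'n" where "cmap \<equiv> snd"

definition cimg :: "('a, 'n) chart \<Rightarrow> (real^'n) set" where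
  "cimg c = cmap c ` cdom c"

definition cinv :: "('a, 'n) chart \<Rightarrow> real^'n \<Rightarrow> 'a" where
  "cinv c = inv_into (cdom c) (cmap c)"

definition overlap :: "('a, 'n) chart \<Rightarrow> ('a, 'n) chart \<Rightarrow> (real^'n) set" where
  "overlap c d = cmap c ` (cdom c \<inter> cdom d)"

definition transition :: "('a, 'n) chart \<Rightarrow> ('a, 'n) chart \<Rightarrow> real^'n \<Rightarrow> real^'n" where
  "transition c d = cmap d \<circ> cinv c"

definition jac :: "('a, 'n::finite) chart \<Rightarrow> ('a, 'n) chart \<Rightarrow> real^'n \<Rightarrow> real^'n^'n" where
  "jac c d x = jacobian (transition c d) (at x)"

text \<open>\<open>T\<close> is the underlying topological space (with point set \<open>topspace T\<close>) and \<open>A\<close> an atlas of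
  class \<open>C\<^sup>\<infinity>\<close>, not necessarily maximal. The dimension is \<open>n = CARD('n)\<close>.\<close>

definition smooth_manifold :: "'a topology \<Rightarrow> ('a, 'n::finite) chart set \<Rightarrow> bool" where
  "smooth_manifold T A \<longleftrightarrow>
     Hausdorff_space T \<and> second_countable T \<and>
     (\<Union>c\<in>A. cdom c) = topspace T \<and>
     (\<forall>c\<in>A. openin T (cdom c) \<and> open (cimg c) \<and>
        homeomorphic_map (subtopology T (cdom c)) (top_of_set (cimg c)) (cmap c)) \<and>
     (\<forall>c\<in>A. \<forall>d\<in>A. smooth_on (overlap c d) (transition c d))"

text \<open>A tangent vector at \<open>p\<close> is the family of its components in all charts around \<open>p\<close>, subject to
  the usual transformation law; entries of the other charts are set to \<open>0\<close>. Linear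
  operations are therefore taken chart by chart.\<close>

type_synonym ('a, 'n) tvec = "('a, 'n) chart \<Rightarrow> real^'n"

definition tangent_space :: "('a, 'n::finite) chart set \<Rightarrow> 'a \<Rightarrow> ('a, 'n) tvec set" where
  "tangent_space A p = {\<xi>.
     (\<forall>c\<in>A. \<forall>d\<in>A. p \<in> cdom c \<longrightarrow> p \<in> cdom d \<longrightarrow> \<xi> d = jac c d (cmap c p) *v \<xi> c) \<and>
     (\<forall>c. \<not> (c \<in> A \<and> p \<in> cdom c) \<longrightarrow> \<xi> c = 0)}"

definition lin_comb :: "real \<Rightarrow> ('a, 'n::finite) tvec \<Rightarrow> real \<Rightarrow> ('a, 'n) tvec \<Rightarrow> ('a, 'n) tvec" where
  "lin_comb a \<xi> b \<eta> = (\<lambda>c. a *\<^sub>R \<xi> c + b *\<^sub>R \<eta> c)"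

definition scale_tvec :: "real \<Rightarrow> ('a, 'n::finite) tvec \<Rightarrow> ('a, 'n) tvec" where
  "scale_tvec a \<xi> = (\<lambda>c. a *\<^sub>R \<xi> c)"

text \<open>The tangent vector \<open>y\<^sup>i \<partial>\<^sub>i\<close> at the point with coordinates \<open>x\<close> in the chart \<open>c\<close>.\<close>

definition vec_at :: "('a, 'n::finite) chart set \<Rightarrow> ('a, 'n) chart \<Rightarrow> real^'n \<Rightarrow> real^'n \<Rightarrow> ('a, 'n) tvec"
  where
  "vec_at A c x y = (\<lambda>d. if d \<in> A \<and> cinv c x \<in> cdom d then jac c d x *v y else 0)"

text \<open>Natural coordinates \<open>(x, y)\<close> on the slit tangent bundle: their range, and their coordinate
  changes.\<close>

definition slit_img :: "('a, 'n) chart \<Rightarrow> ((real^'n) \<times> (real^'n)) set" where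
  "slit_img c = cimg c \<times> (- {0})"

definition slit_overlap :: "('a, 'n) chart \<Rightarrow> ('a, 'n) chart \<Rightarrow> ((real^'n) \<times> (real^'n)) set" where
  "slit_overlap c d = overlap c d \<times> (- {0})"

definition slit_trans ::
  "('a, 'n::finite) chart \<Rightarrow> ('a, 'n) chart \<Rightarrow> (real^'n) \<times> (real^'n) \<Rightarrow> (real^'n) \<times> (real^'n)" where
  "slit_trans c d = (\<lambda>(x, y). (transition c d x, jac c d x *v y))"


section \<open>Finsler structures\<close>

type_synonym ('a, 'n) finsler = "'a \<Rightarrow> ('a, 'n) tvec \<Rightarrow> real"

definition finsler_loc ::
  "('a, 'n::finite) chart set \<Rightarrow> ('a, 'n) finsler \<Rightarrow> ('a, 'n) chart \<Rightarrow> real^'n \<Rightarrow> real^'n \<Rightarrow> real" where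
  "finsler_loc A F c x y = F (cinv c x) (vec_at A c x y)"

text \<open>The following quantities are computed from a local expression \<open>L(x,y)\<close> of \<open>F\<close> in natural
  coordinates: \<open>g\<^sub>i\<^sub>j\<close>, its inverse \<open>g\<^sup>i\<^sup>j\<close>, \<open>A\<^sub>i\<^sub>j\<^sub>k\<close>, \<open>A\<^sup>i\<^sub>j\<^sub>k\<close>, \<open>\<gamma>\<^sup>i\<^sub>j\<^sub>k\<close> and \<open>N\<^sup>i\<^sub>j\<close>.\<close>

definition fund :: "(real^'n::finite \<Rightarrow> real^'n \<Rightarrow> real) \<Rightarrow> real^'n \<Rightarrow> real^'n \<Rightarrow> real^'n^'n" where
  "fund L x y = (\<chi> i j. 1/2 * partial i (\<lambda>y'. partial j (\<lambda>y''. (L x y'')\<^sup>2) y') y)"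

definition fund_inv :: "(real^'n::finite \<Rightarrow> real^'n \<Rightarrow> real) \<Rightarrow> real^'n \<Rightarrow> real^'n \<Rightarrow> real^'n^'n" where
  "fund_inv L x y = matrix_inv (fund L x y)"

definition cartan ::
  "(real^'n::finite \<Rightarrow> real^'n \<Rightarrow> real) \<Rightarrow> real^'n \<Rightarrow> real^'n \<Rightarrow> 'n \<Rightarrow> 'n \<Rightarrow> 'n \<Rightarrow> real" where
  "cartan L x y i j k = L x y / 2 * partial k (\<lambda>y'. fund L x y' $ i $ j) y"

definition cartan_up ::
  "(real^'n::finite \<Rightarrow> real^'n \<Rightarrow> real) \<Rightarrow> real^'n \<Rightarrow> real^'n \<Rightarrow> 'n \<Rightarrow> 'n \<Rightarrow> 'n \<Rightarrow> real" where
  "cartan_up L x y i j k = (\<Sum>l\<in>UNIV. fund_inv L x y $ i $ l * cartan L x y l j k)"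

definition formal_christoffel ::
  "(real^'n::finite \<Rightarrow> real^'n \<Rightarrow> real) \<Rightarrow> real^'n \<Rightarrow> real^'n \<Rightarrow> 'n \<Rightarrow> 'n \<Rightarrow> 'n \<Rightarrow> real" where
  "formal_christoffel L x y i j k =
     1/2 * (\<Sum>s\<in>UNIV. fund_inv L x y $ i $ s *
       (partial k (\<lambda>x'. fund L x' y $ s $ j) x
        - partial s (\<lambda>x'. fund L x' y $ j $ k) x
        + partial j (\<lambda>x'. fund L x' y $ s $ k) x))"

definition nonlin_conn ::
  "(real^'n::finite \<Rightarrow> real^'n \<Rightarrow> real) \<Rightarrow> real^'n \<Rightarrow> real^'n \<Rightarrow> 'n \<Rightarrow> 'n \<Rightarrow> real" where
  "nonlin_conn L x y i j =
     (\<Sum>k\<in>UNIV. formal_christoffel L x y i j k * y $ k)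
     - (\<Sum>k\<in>UNIV. \<Sum>r\<in>UNIV. \<Sum>s\<in>UNIV.
          cartan_up L x y i j k * formal_christoffel L x y k r s * (y $ r * y $ s / L x y))"

text \<open>The 1-form \<open>\<delta>y\<^sup>i = dy\<^sup>i + N\<^sup>i\<^sub>j dx\<^sup>j\<close> at \<open>(x, y)\<close>, evaluated at \<open>u\<^sup>j \<partial>/\<partial>x\<^sup>j + v\<^sup>j \<partial>/\<partial>y\<^sup>j\<close>.\<close>

definition delta_y ::
  "(real^'n::finite \<Rightarrow> real^'n \<Rightarrow> real) \<Rightarrow> real^'n \<Rightarrow> real^'n \<Rightarrow> 'n \<Rightarrow> (real^'n) \<times> (real^'n) \<Rightarrow> real" where
  "delta_y L x y i = (\<lambda>(u, v). v $ i + (\<Sum>j\<in>UNIV. nonlin_conn L x y i j * u $ j))"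

definition finsler_structure ::
  "'a topology \<Rightarrow> ('a, 'n::finite) chart set \<Rightarrow> ('a, 'n) finsler \<Rightarrow> bool" where
  "finsler_structure T A F \<longleftrightarrow>
     (\<forall>p\<in>topspace T. \<forall>\<xi>\<in>tangent_space A p. F p \<xi> \<ge> 0) \<and>
     (\<forall>p\<in>topspace T. \<forall>\<xi>\<in>tangent_space A p. \<forall>a>0. F p (scale_tvec a \<xi>) = a * F p \<xi>) \<and>
     (\<forall>c\<in>A. smooth_on (slit_img c) (\<lambda>(x, y). finsler_loc A F c x y)) \<and>
     (\<forall>c\<in>A. \<forall>(x, y)\<in>slit_img c. \<forall>v. v \<noteq> 0 \<longrightarrow>
        v \<bullet> (fund (finsler_loc A F c) x y *v v) > 0)"

definition indicatrix ::
  "('a, 'n::finite) chart set \<Rightarrow> ('a, 'n) finsler \<Rightarrow> 'a \<Rightarrow> ('a, 'n) tvec set" where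
  "indicatrix A F p = {\<xi> \<in> tangent_space A p. F p \<xi> = 1}"


section \<open>Linear connections\<close>

text \<open>Local connection forms are matrices of 1-forms: \<open>\<omega> z \<zeta> $ i $ j\<close> is \<open>\<omega>\<^sup>i\<^sub>j\<close> at the point \<open>z\<close>,
  evaluated at the tangent vector \<open>\<zeta>\<close>. Here \<open>z\<close> ranges over coordinates \<open>x\<close> of the base manifold
  (for the tangent bundle), or over natural coordinates \<open>(x, y)\<close> of the slit tangent bundle
  (for the pull-back bundle).\<close>

type_synonym ('e, 'n) conn_form = "'e \<Rightarrow> 'e \<Rightarrow> real^'n^'n"

definition smooth_conn_form :: "'e::euclidean_space set \<Rightarrow> ('e, 'n::finite) conn_form \<Rightarrow> bool" where
  "smooth_conn_form S \<omega> \<longleftrightarrow> (\<forall>z\<in>S. linear (\<omega> z)) \<and> (\<forall>\<zeta>. smooth_on S (\<lambda>z. \<omega> z \<zeta>))"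

text \<open>Under a coordinate change \<open>\<Phi>\<close> of the base of the bundle and the frame change
  \<open>\<partial>\<^sub>j = J\<^sup>a\<^sub>j \<partial>'\<^sub>a\<close>, the forms \<open>\<omega>\<close> and \<open>\<omega>'\<close> represent the same connection iff
  \<open>J \<omega> = dJ + (\<Phi>\<^sup>* \<omega>') J\<close>.\<close>

definition gauge_related ::
  "'e::euclidean_space set \<Rightarrow> ('e \<Rightarrow> 'e) \<Rightarrow> ('e \<Rightarrow> real^'n::finite^'n) \<Rightarrow>
   ('e, 'n) conn_form \<Rightarrow> ('e, 'n) conn_form \<Rightarrow> bool" where
  "gauge_related S \<Phi> J \<omega> \<omega>' \<longleftrightarrow>
     (\<forall>z\<in>S. \<forall>\<zeta>. J z ** \<omega> z \<zeta> =
        frechet_derivative J (at z) \<zeta> + \<omega>' (\<Phi> z) (frechet_derivative \<Phi> (at z) \<zeta>) ** J z)"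

definition linear_connection_TM ::
  "('a, 'n::finite) chart set \<Rightarrow> (('a, 'n) chart \<Rightarrow> (real^'n, 'n) conn_form) \<Rightarrow> bool" where
  "linear_connection_TM A D \<longleftrightarrow>
     (\<forall>c\<in>A. smooth_conn_form (cimg c) (D c)) \<and>
     (\<forall>c\<in>A. \<forall>d\<in>A. gauge_related (overlap c d) (transition c d) (jac c d) (D c) (D d))"

definition linear_connection_pullback ::
  "('a, 'n::finite) chart set \<Rightarrow> (('a, 'n) chart \<Rightarrow> ((real^'n) \<times> (real^'n), 'n) conn_form) \<Rightarrow> bool" where
  "linear_connection_pullback A \<omega> \<longleftrightarrow>
     (\<forall>c\<in>A. smooth_conn_form (slit_img c) (\<omega> c)) \<and>
     (\<forall>c\<in>A. \<forall>d\<in>A.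
        gauge_related (slit_overlap c d) (slit_trans c d) (jac c d \<circ> fst) (\<omega> c) (\<omega> d))"

text \<open>\<open>dx\<^sup>j \<and> \<omega>\<^sup>i\<^sub>j = 0\<close> at \<open>z\<close>; the argument \<open>dx\<close> extracts the \<open>x\<close>-components of a tangent vector.\<close>

definition torsion_free_at ::
  "('e \<Rightarrow> real^'n::finite) \<Rightarrow> ('e, 'n) conn_form \<Rightarrow> 'e \<Rightarrow> bool" where
  "torsion_free_at dx \<omega> z \<longleftrightarrow>
     (\<forall>i \<zeta> \<zeta>'. (\<Sum>j\<in>UNIV. dx \<zeta> $ j * \<omega> z \<zeta>' $ i $ j - dx \<zeta>' $ j * \<omega> z \<zeta> $ i $ j) = 0)"

text \<open>The covariant derivative \<open>(\<nabla>G)\<^sub>i\<^sub>j = dG\<^sub>i\<^sub>j - G\<^sub>k\<^sub>j \<omega>\<^sup>k\<^sub>i - G\<^sub>i\<^sub>k \<omega>\<^sup>k\<^sub>j\<close> of a fibre metric.\<close>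

definition cov_deriv_metric ::
  "('e::euclidean_space, 'n::finite) conn_form \<Rightarrow> ('e \<Rightarrow> real^'n^'n) \<Rightarrow> 'e \<Rightarrow> 'e \<Rightarrow> 'n \<Rightarrow> 'n \<Rightarrow> real" where
  "cov_deriv_metric \<omega> G z \<zeta> i j =
     frechet_derivative (\<lambda>z'. G z' $ i $ j) (at z) \<zeta>
     - (\<Sum>k\<in>UNIV. G z $ k $ j * \<omega> z \<zeta> $ k $ i)
     - (\<Sum>k\<in>UNIV. G z $ i $ k * \<omega> z \<zeta> $ k $ j)"

text \<open>The Chern connection is characterized by this predicate: its connection forms are uniquely
  determined on the ranges of the natural coordinates.\<close>

definition chern_connection ::
  "('a, 'n::finite) chart set \<Rightarrow> ('a, 'n) finsler \<Rightarrow>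
   (('a, 'n) chart \<Rightarrow> ((real^'n) \<times> (real^'n), 'n) conn_form) \<Rightarrow> bool" where
  "chern_connection A F \<omega> \<longleftrightarrow>
     linear_connection_pullback A \<omega> \<and>
     (\<forall>c\<in>A. \<forall>(x, y)\<in>slit_img c.
        let L = finsler_loc A F c in
          torsion_free_at fst (\<omega> c) (x, y) \<and>
          (\<forall>\<zeta> i j. cov_deriv_metric (\<omega> c) (\<lambda>(x, y). fund L x y) (x, y) \<zeta> i j =
             2 * (\<Sum>k\<in>UNIV. cartan L x y i j k * (delta_y L x y k \<zeta> / L x y))))"

text \<open>The coefficient \<open>\<Gamma>\<^sup>i\<^sub>j\<^sub>k(x,y)\<close>, that is, \<open>\<omega>\<^sup>i\<^sub>j\<close> evaluated at \<open>\<partial>/\<partial>x\<^sup>k\<close>.\<close>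

definition conn_coeff ::
  "((real^'n::finite) \<times> (real^'n), 'n) conn_form \<Rightarrow> real^'n \<Rightarrow> real^'n \<Rightarrow> 'n \<Rightarrow> 'n \<Rightarrow> 'n \<Rightarrow> real" where
  "conn_coeff \<omega> x y i j k = \<omega> (x, y) (axis k 1, 0) $ i $ j"

definition berwald_structure ::
  "'a topology \<Rightarrow> ('a, 'n::finite) chart set \<Rightarrow> ('a, 'n) finsler \<Rightarrow> bool" where
  "berwald_structure T A F \<longleftrightarrow>
     finsler_structure T A F \<and>
     (\<exists>\<omega>. chern_connection A F \<omega> \<and>
        (\<forall>c\<in>A. \<forall>x\<in>cimg c. \<forall>y y' i j k. y \<noteq> 0 \<longrightarrow> y' \<noteq> 0 \<longrightarrow>
           conn_coeff (\<omega> c) x y i j k = conn_coeff (\<omega> c) x y' i j k))"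

text \<open>The linear Berwald connection: \<open>\<omega>\<^sup>i\<^sub>j = (\<partial>N\<^sup>i\<^sub>j/\<partial>y\<^sup>k) dx\<^sup>k\<close>.\<close>

definition berwald_connection ::
  "('a, 'n::finite) chart set \<Rightarrow> ('a, 'n) finsler \<Rightarrow> ('a, 'n) chart \<Rightarrow> ((real^'n) \<times> (real^'n), 'n) conn_form"
  where
  "berwald_connection A F c = (\<lambda>(x, y) (u, v).
     (\<chi> i j. \<Sum>k\<in>UNIV. partial k (\<lambda>y'. nonlin_conn (finsler_loc A F c) x y' i j) y * u $ k))"


section \<open>Riemannian metrics and the Levi-Civita connection\<close>

type_synonym ('a, 'n) metric = "'a \<Rightarrow> ('a, 'n) tvec \<Rightarrow> ('a, 'n) tvec \<Rightarrow> real"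

text \<open>The components \<open>h\<^sub>i\<^sub>j(x)\<close>.\<close>

definition metric_loc ::
  "('a, 'n::finite) chart set \<Rightarrow> ('a, 'n) metric \<Rightarrow> ('a, 'n) chart \<Rightarrow> real^'n \<Rightarrow> real^'n^'n" where
  "metric_loc A h c x =
     (\<chi> i j. h (cinv c x) (vec_at A c x (axis i 1)) (vec_at A c x (axis j 1)))"

definition riemannian_metric ::
  "'a topology \<Rightarrow> ('a, 'n::finite) chart set \<Rightarrow> ('a, 'n) metric \<Rightarrow> bool" where
  "riemannian_metric T A h \<longleftrightarrow>
     (\<forall>p\<in>topspace T.
        (\<forall>\<xi>\<in>tangent_space A p. \<forall>\<eta>\<in>tangent_space A p. h p \<xi> \<eta> = h p \<eta> \<xi>) \<and>
        (\<forall>\<xi>\<in>tangent_space A p. \<forall>\<eta>\<in>tangent_space A p. \<forall>\<theta>\<in>tangent_space A p. \<forall>a b.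
           h p (lin_comb a \<xi> b \<eta>) \<theta> = a * h p \<xi> \<theta> + b * h p \<eta> \<theta>) \<and>
        (\<forall>\<xi>\<in>tangent_space A p. \<xi> \<noteq> (\<lambda>_. 0) \<longrightarrow> h p \<xi> \<xi> > 0)) \<and>
     (\<forall>c\<in>A. smooth_on (cimg c) (metric_loc A h c))"

text \<open>The fibre metric \<open>\<pi>\<^sup>*h\<close> in natural coordinates.\<close>

definition pullback_metric ::
  "('a, 'n::finite) chart set \<Rightarrow> ('a, 'n) metric \<Rightarrow> ('a, 'n) chart \<Rightarrow> (real^'n) \<times> (real^'n) \<Rightarrow> real^'n^'n" where
  "pullback_metric A h c = (\<lambda>(x, y). metric_loc A h c x)"

definition parallel_pullback_metric ::
  "('a, 'n::finite) chart set \<Rightarrow> (('a, 'n) chart \<Rightarrow> ((real^'n) \<times> (real^'n), 'n) conn_form) \<Rightarrow>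
   ('a, 'n) metric \<Rightarrow> bool" where
  "parallel_pullback_metric A \<omega> h \<longleftrightarrow>
     (\<forall>c\<in>A. \<forall>z\<in>slit_img c. \<forall>\<zeta> i j. cov_deriv_metric (\<omega> c) (pullback_metric A h c) z \<zeta> i j = 0)"

definition levi_civita ::
  "('a, 'n::finite) chart set \<Rightarrow> ('a, 'n) metric \<Rightarrow> (('a, 'n) chart \<Rightarrow> (real^'n, 'n) conn_form) \<Rightarrow> bool"
  where
  "levi_civita A h D \<longleftrightarrow>
     linear_connection_TM A D \<and>
     (\<forall>c\<in>A. \<forall>x\<in>cimg c.
        torsion_free_at id (D c) x \<and>
        (\<forall>u i j. cov_deriv_metric (D c) (metric_loc A h c) x u i j = 0))"


section \<open>Parallel transport\<close>

definition C1_curve_on ::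
  "'a topology \<Rightarrow> ('a, 'n::finite) chart set \<Rightarrow> real set \<Rightarrow> (real \<Rightarrow> 'a) \<Rightarrow> bool" where
  "C1_curve_on T A I \<gamma> \<longleftrightarrow>
     continuous_map (top_of_set I) T \<gamma> \<and>
     (\<forall>c\<in>A. \<exists>v. continuous_on {t \<in> I. \<gamma> t \<in> cdom c} v \<and>
        (\<forall>t\<in>I. \<gamma> t \<in> cdom c \<longrightarrow> ((cmap c \<circ> \<gamma>) has_vector_derivative v t) (at t within I)))"

text \<open>\<open>C\<^sup>1\<close> on each closed piece, so that one-sided velocities exist at the finitely many break
  points (this is stronger than the library notion \<open>piecewise_C1_differentiable_on\<close>).\<close>

definition piecewise_C1_curve ::
  "'a topology \<Rightarrow> ('a, 'n::finite) chart set \<Rightarrow> (real \<Rightarrow> 'a) \<Rightarrow> bool" where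
  "piecewise_C1_curve T A \<gamma> \<longleftrightarrow>
     continuous_map (top_of_set {0..1}) T \<gamma> \<and>
     (\<exists>S. finite S \<and>
        (\<forall>a b. 0 \<le> a \<longrightarrow> a < b \<longrightarrow> b \<le> 1 \<longrightarrow> {a<..<b} \<inter> S = {} \<longrightarrow> C1_curve_on T A {a..b} \<gamma>))"

text \<open>A continuous vector field \<open>X\<close> along \<open>\<gamma>\<close> with \<open>dX\<^sup>i/dt + \<omega>\<^sup>i\<^sub>j(d\<gamma>/dt) X\<^sup>j = 0\<close> except for
  finitely many \<open>t\<close>.\<close>

definition parallel_along ::
  "('a, 'n::finite) chart set \<Rightarrow> (('a, 'n) chart \<Rightarrow> (real^'n, 'n) conn_form) \<Rightarrow> (real \<Rightarrow> 'a) \<Rightarrow>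
   (real \<Rightarrow> ('a, 'n) tvec) \<Rightarrow> bool" where
  "parallel_along A D \<gamma> X \<longleftrightarrow>
     (\<forall>t\<in>{0..1}. X t \<in> tangent_space A (\<gamma> t)) \<and>
     (\<forall>c\<in>A. continuous_on {t \<in> {0..1}. \<gamma> t \<in> cdom c} (\<lambda>t. X t c)) \<and>
     (\<exists>S. finite S \<and>
        (\<forall>t\<in>{0..1} - S. \<forall>c\<in>A. \<gamma> t \<in> cdom c \<longrightarrow>
           (\<exists>v. ((cmap c \<circ> \<gamma>) has_vector_derivative v) (at t within {0..1}) \<and>
              ((\<lambda>s. X s c) has_vector_derivative - (D c (cmap c (\<gamma> t)) v *v X t c))
                (at t within {0..1}))))"

definition parallel_transport ::
  "('a, 'n::finite) chart set \<Rightarrow> (('a, 'n) chart \<Rightarrow> (real^'n, 'n) conn_form) \<Rightarrow> (real \<Rightarrow> 'a) \<Rightarrow>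
   ('a, 'n) tvec \<Rightarrow> ('a, 'n) tvec" where
  "parallel_transport A D \<gamma> \<xi> = (THE \<eta>. \<exists>X. parallel_along A D \<gamma> X \<and> X 0 = \<xi> \<and> X 1 = \<eta>)"

definition leaves_indicatrix_invariant ::
  "'a topology \<Rightarrow> ('a, 'n::finite) chart set \<Rightarrow> (('a, 'n) chart \<Rightarrow> (real^'n, 'n) conn_form) \<Rightarrow>
   ('a, 'n) finsler \<Rightarrow> bool" where
  "leaves_indicatrix_invariant T A D F \<longleftrightarrow>
     (\<forall>\<gamma>. piecewise_C1_curve T A \<gamma> \<longrightarrow>
        parallel_transport A D \<gamma> ` indicatrix A F (\<gamma> 0) = indicatrix A F (\<gamma> 1))"

end

theory Submission
  imports Defs
begin

text \<open>Let \<open>\<Gamma>\<close> be the coefficients of the Chern connection. Contracting its structure equation with \<open>y\<close>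
  removes the Cartan tensor, which gives two facts: \<open>N\<^sup>i\<^sub>j = \<Gamma>\<^sup>i\<^sub>j\<^sub>k y\<^sup>k\<close>, and the derivative of \<open>F\<close> vanishes along
  the horizontal vectors \<open>(u, -\<Gamma>(u) y)\<close>. On a Berwald space \<open>\<Gamma>\<close> depends on \<open>x\<close> only, so the first fact
  identifies the linear Berwald connection with \<open>\<Gamma>\<close>. If it preserves \<open>h\<close>, then \<open>\<Gamma>\<close> is torsion-free and
  metric for \<open>h\<close>, hence it is the Levi-Civita connection of \<open>h\<close>. By the second fact \<open>F\<close> is then constant
  along parallel vector fields. Parallel transport is unique because \<open>h(X, X)\<close> is constant along a
  parallel field \<open>X\<close>, and it exists by solving a linear differential equation on short pieces of
  the curve and gluing.\<close>

section \<open>Smooth functions and symmetry of second derivatives\<close>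

text \<open>The Chern equation has the nonlinear connection \<open>N\<close> on its right-hand side,
  while \<open>N\<close> is built from the very derivatives of \<open>g\<close> that this equation
  computes. The circle breaks because the defining formula of \<open>N\<close> loses its Cartan term
  when contracted with \<open>y\<close>, so the vector \<open>N y\<close> is known independently of
  the equation. That \<open>y\<close> annihilates the Cartan tensor rests on the homogeneity of
  \<open>F^2\<close>: Euler's identity is differentiated twice and combined with the symmetry of
  second derivatives. \<open>F\<close> is smooth only off the zero section, so its constancy along a
  parallel field requires a field that never vanishes. The metric \<open>h\<close> supplies this.
  \<open>parallel_transport\<close> is a definite description and has a usable value only after
  existence and uniqueness are known. Equality of the two indicatrices, rather than an inclusion,
  also calls for parallel fields with a prescribed value at the final end of the curve.\<close>

lemma has_derivative_frechet:
  "f differentiable (at x) \<Longrightarrow> (f has_derivative frechet_derivative f (at x)) (at x)"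
  by (simp add: frechet_derivative_works)

lemma frechet_derivative_eq:
  "(f has_derivative f') (at x) \<Longrightarrow> frechet_derivative f (at x) = f'"
  using frechet_derivative_at by metis

lemma has_derivative_along_line:
  assumes "(f has_derivative f') (at (x + s *\<^sub>R v))"
  shows "((\<lambda>t. f (x + t *\<^sub>R v)) has_derivative (\<lambda>t. t *\<^sub>R f' v)) (at s)"
proof -
  have "((\<lambda>t. x + t *\<^sub>R v) has_derivative (\<lambda>t. t *\<^sub>R v)) (at s)"
    by (auto intro!: derivative_eq_intros)
  from has_derivative_compose[OF this assms]
  have "((\<lambda>t. f (x + t *\<^sub>R v)) has_derivative (\<lambda>t. f' (t *\<^sub>R v))) (at s)" .
  then show ?thesis
    using linear_scale[OF has_derivative_linear[OF assms]] by simp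
qed

lemma DERIV_along_line:
  fixes f :: "'e::real_normed_vector \<Rightarrow> real"
  assumes "(f has_derivative f') (at (x + s *\<^sub>R v))"
  shows "((\<lambda>t. f (x + t *\<^sub>R v)) has_real_derivative f' v) (at s)"
  using has_derivative_along_line[OF assms]
  by (simp add: has_field_derivative_def mult_commute_abs)

lemma partial_eq:
  assumes "(f has_derivative f') (at x)"
  shows "partial i f x = f' (axis i 1)"
  unfolding partial_def by (rule DERIV_imp_deriv, rule DERIV_along_line) (use assms in simp)

text \<open>Openness of \<open>S\<close> is essential: the derivatives are those of functions on the
  whole space, and values on \<open>S\<close> determine them only because every point of
  \<open>S\<close> has a neighbourhood inside \<open>S\<close>.\<close>

lemma Ck_on_cong:
  assumes "open S" "\<And>x. x \<in> S \<Longrightarrow> f x = g x" "Ck_on k S f"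
  shows "Ck_on k S g"
  using assms(2,3)
proof (induction k arbitrary: f g)
  case 0
  then show ?case by (metis Ck_on.simps(1) continuous_on_cong)
next
  case (Suc k)
  have d: "(g has_derivative frechet_derivative f (at x)) (at x)" if "x \<in> S" for x
  proof -
    have "(f has_derivative frechet_derivative f (at x)) (at x)"
      using Suc.prems(2) that by (simp add: has_derivative_frechet)
    then show ?thesis
      by (rule has_derivative_transform_within_open[OF _ assms(1) that]) (simp add: Suc.prems)
  qed
  have "Ck_on k S (\<lambda>x. frechet_derivative g (at x) v)" for v
  proof (rule Suc.IH)
    show "frechet_derivative f (at x) v = frechet_derivative g (at x) v" if "x \<in> S" for x
      using frechet_derivative_eq[OF d[OF that]] by simp
    show "Ck_on k S (\<lambda>x. frechet_derivative f (at x) v)"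
      using Suc.prems(2) by simp
  qed
  then show ?case using d by (auto simp: differentiable_def)
qed

text \<open>Serves the product rule, where one factor stays undifferentiated and has to be lowered
  from order \<open>Suc k\<close> to order \<open>k\<close>.\<close>

lemma Ck_on_SucD: "Ck_on (Suc k) S f \<Longrightarrow> Ck_on k S f"
proof (induction k arbitrary: f)
  case 0
  then have "\<forall>x\<in>S. isCont f x"
    unfolding Ck_on.simps(2) using differentiable_imp_continuous_within by blast
  then show ?case by (simp add: continuous_at_imp_continuous_on)
next
  case (Suc k)
  have "f differentiable (at x)" if "x \<in> S" for x
    using Suc.prems that Ck_on.simps(2)[of "Suc k" S f] by simp
  moreover have "Ck_on k S (\<lambda>x. frechet_derivative f (at x) v)" for v
    using Suc.prems Ck_on.simps(2)[of "Suc k" S f] by (intro Suc.IH) simp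
  ultimately show ?case unfolding Ck_on.simps(2)[of k S f] by simp
qed

lemma Ck_on_add:
  assumes "open S" "Ck_on k S f" "Ck_on k S g"
  shows "Ck_on k S (\<lambda>x. f x + g x)"
  using assms(2,3)
proof (induction k arbitrary: f g)
  case 0
  then show ?case by (simp add: continuous_on_add)
next
  case (Suc k)
  have d: "((\<lambda>x. f x + g x) has_derivative
      (\<lambda>v. frechet_derivative f (at x) v + frechet_derivative g (at x) v)) (at x)" if "x \<in> S" for x
    using Suc.prems that by (auto intro!: has_derivative_add has_derivative_frechet)
  have "Ck_on k S (\<lambda>x. frechet_derivative (\<lambda>x. f x + g x) (at x) v)" for v
    by (rule Ck_on_cong[OF assms(1) _ Suc.IH])
       (use Suc.prems frechet_derivative_eq[OF d] in auto)
  then show ?case using d by (auto simp: differentiable_def)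
qed

lemma Ck_on_mult:
  fixes f g :: "'e::euclidean_space \<Rightarrow> real"
  assumes "open S" "Ck_on k S f" "Ck_on k S g"
  shows "Ck_on k S (\<lambda>x. f x * g x)"
  using assms(2,3)
proof (induction k arbitrary: f g)
  case 0
  then show ?case by (simp add: continuous_on_mult)
next
  case (Suc k)
  have d: "((\<lambda>x. f x * g x) has_derivative
      (\<lambda>v. f x * frechet_derivative g (at x) v + frechet_derivative f (at x) v * g x)) (at x)"
    if "x \<in> S" for x
    using Suc.prems that by (auto intro!: has_derivative_mult has_derivative_frechet)
  have "Ck_on k S (\<lambda>x. frechet_derivative (\<lambda>x. f x * g x) (at x) v)" for v
  proof (rule Ck_on_cong[OF assms(1)])
    show "Ck_on k S (\<lambda>x. f x * frechet_derivative g (at x) v + frechet_derivative f (at x) v * g x)"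
      using Suc.prems Suc.prems[THEN Ck_on_SucD] by (intro Ck_on_add[OF assms(1)] Suc.IH) auto
  qed (simp add: frechet_derivative_eq[OF d])
  then show ?case using d by (auto simp: differentiable_def)
qed

lemma smooth_on_mult:
  fixes f g :: "'e::euclidean_space \<Rightarrow> real"
  assumes "open S" "smooth_on S f" "smooth_on S g"
  shows "smooth_on S (\<lambda>x. f x * g x)"
  using assms Ck_on_mult unfolding smooth_on_def by blast

lemma smooth_on_frechet_derivative:
  "smooth_on S f \<Longrightarrow> smooth_on S (\<lambda>x. frechet_derivative f (at x) v)"
  unfolding smooth_on_def
proof
  fix k assume "\<forall>k. Ck_on k S f"
  then have "Ck_on (Suc k) S f" ..
  then show "Ck_on k S (\<lambda>x. frechet_derivative f (at x) v)" by simp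
qed

lemma smooth_on_has_derivative:
  assumes "smooth_on S f" "x \<in> S"
  shows "(f has_derivative frechet_derivative f (at x)) (at x)"
proof -
  have "Ck_on (Suc 0) S f" using assms(1) unfolding smooth_on_def ..
  then show ?thesis using assms(2) by (simp add: has_derivative_frechet)
qed

lemma smooth_on_imp_continuous_on: "smooth_on S f \<Longrightarrow> continuous_on S f"
  unfolding smooth_on_def by (drule spec[of _ 0]) simp

text \<open>The second difference quotient tends to the mixed derivative, and it is symmetric in the two
  directions.\<close>

lemma second_difference_tendsto:
  fixes f :: "'e::euclidean_space \<Rightarrow> real"
  assumes S: "open S" "z \<in> S" and f: "smooth_on S f"
  shows "((\<lambda>t. (f (z + t *\<^sub>R u + t *\<^sub>R v) - f (z + t *\<^sub>R u) - f (z + t *\<^sub>R v) + f z) / t\<^sup>2) \<longlongrightarrow>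
     frechet_derivative (\<lambda>x. frechet_derivative f (at x) u) (at z) v) (at_right 0)"
proof -
  define fu where "fu = (\<lambda>x. frechet_derivative f (at x) u)"
  define fuv where "fuv = (\<lambda>x. frechet_derivative fu (at x) v)"
  have smooth: "smooth_on S fu" "smooth_on S fuv"
    unfolding fu_def fuv_def by (intro smooth_on_frechet_derivative f)+
  have df: "(f has_derivative frechet_derivative f (at x)) (at x)" if "x \<in> S" for x
    using smooth_on_has_derivative[OF f that] .
  have dfu: "(fu has_derivative frechet_derivative fu (at x)) (at x)" if "x \<in> S" for x
    using smooth_on_has_derivative[OF smooth(1) that] .
  have "((\<lambda>t. (f (z + t *\<^sub>R u + t *\<^sub>R v) - f (z + t *\<^sub>R u) - f (z + t *\<^sub>R v) + f z) / t\<^sup>2) \<longlongrightarrow> fuv z)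
    (at_right 0)"
  proof (rule tendstoI)
    fix e :: real assume "e > 0"
    have "continuous (at z) fuv"
      using smooth_on_imp_continuous_on[OF smooth(2)] S continuous_on_eq_continuous_at by blast
    then obtain r1 where r1: "r1 > 0" "\<And>x. dist x z < r1 \<Longrightarrow> dist (fuv x) (fuv z) < e"
      using \<open>e > 0\<close> unfolding continuous_at_eps_delta dist_norm by blast
    obtain r2 where r2: "r2 > 0" "ball z r2 \<subseteq> S" using S openE by blast
    define r where "r = min r1 r2"
    have r: "r > 0" using r1 r2 by (simp add: r_def)
    \<comment> \<open>Steps shorter than \<open>d\<close> along both \<open>u\<close> and
      \<open>v\<close> stay within distance \<open>r\<close> of \<open>z\<close>. The summand 1
      keeps the denominator positive when both directions vanish.\<close>
    define d where "d = r / (norm u + norm v + 1)"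
    have "d > 0" using r unfolding d_def
      by (simp add: add_nonneg_pos)
    have near: "dist (z + s *\<^sub>R u + t *\<^sub>R v) z < r" if "0 \<le> s" "0 \<le> t" "s < d" "t < d" for s t
    proof -
      have "norm (s *\<^sub>R u + t *\<^sub>R v) \<le> s * norm u + t * norm v"
        using norm_triangle_ineq[of "s *\<^sub>R u" "t *\<^sub>R v"] that by simp
      also have "\<dots> \<le> d * norm u + d * norm v"
        using that by (intro add_mono mult_right_mono) auto
      also have "\<dots> < d * (norm u + norm v + 1)"
        using \<open>d > 0\<close> by (simp add: distrib_left)
      also have "\<dots> = r" unfolding d_def
        by (simp add: add_nonneg_pos order_less_imp_not_eq2)
      finally show ?thesis by (simp add: dist_norm add.assoc)
    qed
    have inS: "z + s *\<^sub>R u + t *\<^sub>R v \<in> S" if "0 \<le> s" "0 \<le> t" "s < d" "t < d" for s t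
      using near[OF that] r2(2) by (auto simp: r_def dist_commute subset_iff)
    have main: "dist ((f (z + t *\<^sub>R u + t *\<^sub>R v) - f (z + t *\<^sub>R u) - f (z + t *\<^sub>R v) + f z) / t\<^sup>2) (fuv z) < e"
      if t: "0 < t" "t < d" for t
    proof -
      \<comment> \<open>The second difference is the increment of \<open>p\<close> from 0 to
        \<open>t\<close>. One mean value theorem in direction \<open>u\<close> and a second one in
        direction \<open>v\<close> turn it into \<open>t^2\<close> times the mixed derivative at a
        nearby point.\<close>
      define p where "p = (\<lambda>s. f (z + t *\<^sub>R v + s *\<^sub>R u) - f (z + s *\<^sub>R u))"
      have dp: "(p has_real_derivative fu (z + t *\<^sub>R v + s *\<^sub>R u) - fu (z + s *\<^sub>R u)) (at s)"
        if s: "0 \<le> s" "s \<le> t" for s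
      proof -
        have "z + t *\<^sub>R v + s *\<^sub>R u \<in> S" "z + s *\<^sub>R u \<in> S"
          using inS[of s t] inS[of s 0] s t by (auto simp: algebra_simps)
        then show ?thesis unfolding p_def fu_def
          by (intro DERIV_diff DERIV_along_line df)
      qed
      obtain s where s: "0 < s" "s < t" and
        ps: "p t - p 0 = (t - 0) * (fu (z + t *\<^sub>R v + s *\<^sub>R u) - fu (z + s *\<^sub>R u))"
        using MVT2[OF t(1), of p "\<lambda>s. fu (z + t *\<^sub>R v + s *\<^sub>R u) - fu (z + s *\<^sub>R u)"] dp by auto
      have dq: "((\<lambda>r. fu (z + s *\<^sub>R u + r *\<^sub>R v)) has_real_derivative fuv (z + s *\<^sub>R u + r *\<^sub>R v)) (at r)"
        if "0 \<le> r" "r \<le> t" for r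
        unfolding fuv_def using inS[of s r] that s t by (intro DERIV_along_line dfu) auto
      obtain r where r: "0 < r" "r < t" and
        "fu (z + s *\<^sub>R u + t *\<^sub>R v) - fu (z + s *\<^sub>R u + 0 *\<^sub>R v) = (t - 0) * fuv (z + s *\<^sub>R u + r *\<^sub>R v)"
        using MVT2[OF t(1), of "\<lambda>r. fu (z + s *\<^sub>R u + r *\<^sub>R v)" "\<lambda>r. fuv (z + s *\<^sub>R u + r *\<^sub>R v)"] dq
        by auto
      with ps have "p t - p 0 = t\<^sup>2 * fuv (z + s *\<^sub>R u + r *\<^sub>R v)"
        by (simp add: power2_eq_square algebra_simps)
      moreover have "p t - p 0 = f (z + t *\<^sub>R u + t *\<^sub>R v) - f (z + t *\<^sub>R u) - f (z + t *\<^sub>R v) + f z"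
        by (simp add: p_def algebra_simps)
      ultimately have "(f (z + t *\<^sub>R u + t *\<^sub>R v) - f (z + t *\<^sub>R u) - f (z + t *\<^sub>R v) + f z) / t\<^sup>2
          = fuv (z + s *\<^sub>R u + r *\<^sub>R v)" using t by simp
      then show ?thesis using r1(2) near[of s r] s r t by (simp add: r_def)
    qed
    show "\<forall>\<^sub>F t in at_right 0. dist ((f (z + t *\<^sub>R u + t *\<^sub>R v) - f (z + t *\<^sub>R u) - f (z + t *\<^sub>R v) + f z) / t\<^sup>2) (fuv z) < e"
      using eventually_at_right_real[OF \<open>d > 0\<close>] by eventually_elim (use main in auto)
  qed
  then show ?thesis by (simp add: fuv_def fu_def)
qed

lemma second_derivative_commute:
  fixes f :: "'e::euclidean_space \<Rightarrow> real"
  assumes "open S" "z \<in> S" "smooth_on S f"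
  shows "frechet_derivative (\<lambda>x. frechet_derivative f (at x) u) (at z) v =
    frechet_derivative (\<lambda>x. frechet_derivative f (at x) v) (at z) u"
proof (rule tendsto_unique)
  let ?q = "\<lambda>t. (f (z + t *\<^sub>R u + t *\<^sub>R v) - f (z + t *\<^sub>R u) - f (z + t *\<^sub>R v) + f z) / t\<^sup>2"
  show "(?q \<longlongrightarrow> frechet_derivative (\<lambda>x. frechet_derivative f (at x) u) (at z) v) (at_right 0)"
    by (rule second_difference_tendsto[OF assms])
  show "(?q \<longlongrightarrow> frechet_derivative (\<lambda>x. frechet_derivative f (at x) v) (at z) u) (at_right 0)"
    using second_difference_tendsto[OF assms, of v u] by (simp add: algebra_simps)
qed simp


section \<open>Linear differential equations\<close>

text \<open>Picard iteration as a contraction of the complete space of bounded continuous functions.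
  The integral operator is a difference of two integrals, at \<open>t\<close> and at
  \<open>t0\<close>, each with Lipschitz constant \<open>M * (b - a)\<close>; the factor 4 in the
  hypothesis therefore makes the contraction constant 1/2.\<close>

lemma lipschitz_ode_exists:
  fixes f :: "real \<Rightarrow> 'b::euclidean_space \<Rightarrow> 'b"
  assumes t0: "t0 \<in> {a..b}"
    and cont: "\<And>x. continuous_on {a..b} x \<Longrightarrow> continuous_on {a..b} (\<lambda>t. f t (x t))"
    and lip: "\<And>t x y. t \<in> {a..b} \<Longrightarrow> norm (f t x - f t y) \<le> M * norm (x - y)"
    and M: "0 \<le> M" "4 * (M * (b - a)) \<le> 1"
  shows "\<exists>x. x t0 = x0 \<and>
    (\<forall>t\<in>{a..b}. (x has_vector_derivative f t (x t)) (at t within {a..b}))"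
proof -
  have ab: "a \<le> b" using t0 by simp
  \<comment> \<open>Integrating from \<open>a\<close> and subtracting the value at \<open>t0\<close>
    avoids oriented integrals when \<open>t < t0\<close>.\<close>
  define I where "I = (\<lambda>x t. integral {a..t} (\<lambda>s. f s (x s)))"
  \<comment> \<open>Elements of the function space live on the whole real line; clamping the time to
    \<open>{a..b}\<close> extends the iterates there continuously and boundedly.\<close>
  define cl where "cl = (\<lambda>t. max a (min t b))"
  have cl: "cl t \<in> {a..b}" for t using ab by (auto simp: cl_def)
  have clid: "cl t = t" if "t \<in> {a..b}" for t using that by (auto simp: cl_def)
  have fx: "continuous_on {a..b} (\<lambda>s. f s (apply_bcontfun x s))" for x
    by (rule cont) simp
  have Icont: "continuous_on {a..b} (I (apply_bcontfun x))" for x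
    unfolding I_def
    by (rule indefinite_integral_continuous_1) (rule integrable_continuous_real[OF fx])
  define P where "P = (\<lambda>x t. x0 + I (apply_bcontfun x) (cl t) - I (apply_bcontfun x) t0)"
  have P: "P x \<in> bcontfun" for x
  proof -
    have "continuous_on UNIV cl" unfolding cl_def by (intro continuous_intros)
    then have "continuous_on UNIV (\<lambda>t. I (apply_bcontfun x) (cl t))"
      by (rule continuous_on_compose2[OF Icont]) (use cl in auto)
    then have c: "continuous_on UNIV (P x)" unfolding P_def by (intro continuous_intros)
    have "bounded ((\<lambda>t. x0 + I (apply_bcontfun x) t - I (apply_bcontfun x) t0) ` {a..b})"
      by (intro compact_imp_bounded compact_continuous_image continuous_intros Icont) auto
    then have "bounded (range (P x))"
      by (rule bounded_subset) (use cl in \<open>auto simp: P_def\<close>)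
    with c show ?thesis by (simp add: bcontfun_def)
  qed
  define \<Phi> where "\<Phi> = (\<lambda>x. Bcontfun (P x))"
  have \<Phi>: "apply_bcontfun (\<Phi> x) = P x" for x
    unfolding \<Phi>_def using P by (rule Bcontfun_inverse)
  have Idist: "norm (I (apply_bcontfun x) t - I (apply_bcontfun y) t) \<le> M * (b - a) * dist x y"
    if t: "t \<in> {a..b}" for x y t
  proof -
    have int: "(\<lambda>s. f s (apply_bcontfun z s)) integrable_on {a..t}" for z
      by (rule integrable_continuous_real[OF continuous_on_subset[OF fx]]) (use t in auto)
    have "I (apply_bcontfun x) t - I (apply_bcontfun y) t
        = integral {a..t} (\<lambda>s. f s (apply_bcontfun x s) - f s (apply_bcontfun y s))"
      unfolding I_def by (rule integral_diff[symmetric]) (rule int)+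
    also have "norm \<dots> \<le> (M * dist x y) * (t - a)"
    proof (rule integral_bound)
      show "continuous_on {a..t} (\<lambda>s. f s (apply_bcontfun x s) - f s (apply_bcontfun y s))"
        by (intro continuous_on_diff continuous_on_subset[OF fx]) (use t in auto)
      show "norm (f s (apply_bcontfun x s) - f s (apply_bcontfun y s)) \<le> M * dist x y"
        if "s \<in> {a..t}" for s
      proof -
        have "norm (f s (apply_bcontfun x s) - f s (apply_bcontfun y s))
            \<le> M * norm (apply_bcontfun x s - apply_bcontfun y s)"
          by (rule lip) (use that t in auto)
        also have "\<dots> \<le> M * dist x y"
          using dist_bounded[of x s y] M(1) by (intro mult_left_mono) (auto simp: dist_norm)
        finally show ?thesis .
      qed
    qed (use t in auto)
    also have "\<dots> \<le> (M * dist x y) * (b - a)"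
      using t M(1) by (intro mult_left_mono) auto
    finally show ?thesis by (simp add: ac_simps)
  qed
  have "\<exists>!x. \<Phi> x = x"
  proof (rule banach_fix_type)
    show "0 \<le> (1/2 :: real)" "1/2 < (1::real)" by auto
    show "\<forall>x y. dist (\<Phi> x) (\<Phi> y) \<le> 1/2 * dist x y"
    proof (intro allI, rule dist_bound)
      fix x y t
      have "dist (apply_bcontfun (\<Phi> x) t) (apply_bcontfun (\<Phi> y) t)
          = norm ((I (apply_bcontfun x) (cl t) - I (apply_bcontfun y) (cl t))
              - (I (apply_bcontfun x) t0 - I (apply_bcontfun y) t0))"
        by (simp add: \<Phi> P_def dist_norm algebra_simps)
      also have "\<dots> \<le> M * (b - a) * dist x y + M * (b - a) * dist x y"
        using norm_triangle_ineq4 Idist[OF cl] Idist[OF t0] by (meson add_mono order_trans)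
      also have "\<dots> = (2 * (M * (b - a))) * dist x y" by simp
      also have "\<dots> \<le> 1/2 * dist x y"
        using M(2) by (intro mult_right_mono) auto
      finally show "dist (apply_bcontfun (\<Phi> x) t) (apply_bcontfun (\<Phi> y) t) \<le> 1/2 * dist x y" .
    qed
  qed
  then obtain x where x: "\<Phi> x = x" by blast
  have xt: "apply_bcontfun x t = x0 + I (apply_bcontfun x) t - I (apply_bcontfun x) t0"
    if "t \<in> {a..b}" for t
  proof -
    have "apply_bcontfun x t = P x t" using \<Phi>[of x] x by simp
    then show ?thesis using clid[OF that] by (simp add: P_def)
  qed
  show ?thesis
  proof (intro exI[of _ "apply_bcontfun x"] conjI ballI)
    show "apply_bcontfun x t0 = x0" using xt[OF t0] by simp
    fix t assume t: "t \<in> {a..b}"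
    have "(I (apply_bcontfun x) has_vector_derivative f t (apply_bcontfun x t)) (at t within {a..b})"
      unfolding I_def by (rule integral_has_vector_derivative[OF fx t])
    then have "((\<lambda>t. x0 + I (apply_bcontfun x) t - I (apply_bcontfun x) t0)
        has_vector_derivative f t (apply_bcontfun x t)) (at t within {a..b})"
      by (auto intro!: derivative_eq_intros)
    then show "(apply_bcontfun x has_vector_derivative f t (apply_bcontfun x t)) (at t within {a..b})"
      by (rule has_vector_derivative_transform[OF t, rotated]) (use xt in auto)
  qed
qed

lemma bounded_bilinear_matrix_vector: "bounded_bilinear ((*v) :: real^'n^'m \<Rightarrow> real^'n \<Rightarrow> real^'m)"
  by (rule bilinear_conv_bounded_bilinear[THEN iffD1])
     (auto simp: bilinear_def linear_iff matrix_vector_mult_def vec_eq_iff algebra_simps sum.distrib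
       sum_distrib_left)

text \<open>The Lipschitz constant is a bound for \<open>B\<close> on the compact interval, so the
  admissible length \<open>d\<close> is the same for all subintervals, base times and initial
  values.\<close>

lemma linear_ode_exists:
  fixes B :: "real \<Rightarrow> real^'n^'n"
  assumes B: "continuous_on {p..q} B"
  shows "\<exists>d>0. \<forall>a b t0 x0. p \<le> a \<longrightarrow> b \<le> q \<longrightarrow> b - a < d \<longrightarrow> t0 \<in> {a..b} \<longrightarrow>
    (\<exists>x. x t0 = x0 \<and> (\<forall>t\<in>{a..b}. (x has_vector_derivative B t *v x t) (at t within {a..b})))"
proof -
  interpret mv: bounded_bilinear "(*v) :: real^'n^'n \<Rightarrow> real^'n \<Rightarrow> real^'n"
    by (rule bounded_bilinear_matrix_vector)
  obtain K where K: "0 \<le> K" "\<And>(C::real^'n^'n) y. norm (C *v y) \<le> norm C * norm y * K"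
    using mv.nonneg_bounded by blast
  have "bounded (B ` {p..q})" by (intro compact_imp_bounded compact_continuous_image B) simp
  then obtain b0 where b0: "0 < b0" "\<And>t. t \<in> {p..q} \<Longrightarrow> norm (B t) \<le> b0"
    unfolding bounded_pos by auto
  define M where "M = b0 * K"
  have M: "0 \<le> M" using b0 K by (simp add: M_def)
  show ?thesis
  \<comment> \<open>The bound \<open>4 * M * (b - a) \<le> 1\<close> is what the contraction needs;
    the summand 1 covers \<open>M = 0\<close>.\<close>
  proof (intro exI[of _ "1 / (4 * M + 1)"] conjI allI impI)
    show "0 < 1 / (4 * M + 1)" using M by simp
    fix a b t0 x0 assume ab: "p \<le> a" "b \<le> q" "b - a < 1 / (4 * M + 1)" "t0 \<in> {a..b}"
    show "\<exists>x. x t0 = x0 \<and> (\<forall>t\<in>{a..b}. (x has_vector_derivative B t *v x t) (at t within {a..b}))"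
    proof (rule lipschitz_ode_exists[OF ab(4)])
      show "continuous_on {a..b} (\<lambda>t. B t *v x t)" if "continuous_on {a..b} x" for x
        by (intro mv.continuous_on that continuous_on_subset[OF B]) (use ab in auto)
      show "norm (B t *v x - B t *v y) \<le> M * norm (x - y)" if "t \<in> {a..b}" for t x y
      proof -
        have "norm (B t *v (x - y)) \<le> norm (B t) * norm (x - y) * K" by (rule K)
        also have "\<dots> \<le> b0 * norm (x - y) * K"
          using b0(2)[of t] that ab K(1) by (intro mult_right_mono) auto
        finally show ?thesis by (simp add: M_def mv.diff_right ac_simps)
      qed
      show "4 * (M * (b - a)) \<le> 1"
      proof -
        have "(4 * M + 1) * (b - a) \<le> 1" using ab(3) M by (simp add: field_simps)
        then show ?thesis using ab(4) by (simp add: algebra_simps)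
      qed
    qed (rule M)
  qed
qed


section \<open>The Chern connection in natural coordinates\<close>

text \<open>\<open>matrix_inv\<close> is a choice, so it obeys the inverse law only once some
  inverse is known to exist. Definiteness gives injectivity, hence invertibility.\<close>

lemma pos_def_matrix_inv:
  fixes G :: "real^'n^'n"
  assumes "\<And>v. v \<noteq> 0 \<Longrightarrow> v \<bullet> (G *v v) > 0"
  shows "matrix_inv G ** G = mat 1"
proof -
  have "inj ((*v) G)"
  proof (rule injI)
    fix v w assume "G *v v = G *v w"
    then have "(v - w) \<bullet> (G *v (v - w)) = 0" by (simp add: matrix_vector_mult_diff_distrib)
    then show "v = w" using assms[of "v - w"] by force
  qed
  then have "invertible G" using invertible_left_inverse matrix_left_invertible_injective by blast
  then have "\<exists>B. G ** B = mat 1 \<and> B ** G = mat 1" by (simp add: invertible_def)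
  then show ?thesis unfolding matrix_inv_def by (rule someI_ex[THEN conjunct2])
qed

lemma sum_mult_sum_assoc:
  fixes a c :: "_ \<Rightarrow> real"
  shows "(\<Sum>s\<in>S. a s * (\<Sum>l\<in>T. b s l * c l)) = (\<Sum>l\<in>T. (\<Sum>s\<in>S. a s * b s l) * c l)"
  unfolding sum_distrib_left sum_distrib_right by (subst sum.swap) (simp add: mult.assoc)

text \<open>Pure index algebra behind \<open>N = \<Gamma> y\<close>; \<open>G\<close> stands for the
  Chern coefficients, \<open>gam\<close> for the formal Christoffel symbols, \<open>C\<close> and
  \<open>Cu\<close> for the Cartan tensor. Solving the Chern equation for \<open>gam\<close> and
  contracting with \<open>y\<close> leaves \<open>G y\<close> plus a single Cartan term, which
  involves \<open>N\<close> only through \<open>N y\<close>. The correction term in the definition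
  of \<open>N\<close> is exactly this term with the opposite sign.\<close>

lemma nonlinear_connection_identity:
  fixes g gi :: "'n::finite \<Rightarrow> 'n \<Rightarrow> real" and dg C G gam Cu :: "'n \<Rightarrow> 'n \<Rightarrow> 'n \<Rightarrow> real"
    and N :: "'n \<Rightarrow> 'n \<Rightarrow> real" and y :: "'n \<Rightarrow> real" and F :: real
  assumes inv: "\<And>i j. (\<Sum>s\<in>UNIV. gi i s * g s j) = (if i = j then 1 else 0)"
    and gsym: "\<And>i j. g i j = g j i"
    and Csym: "\<And>i j k. C i j k = C j i k"
    and Cy: "\<And>j k. (\<Sum>i\<in>UNIV. C i j k * y i) = 0"
    and Gsym: "\<And>i j k. G i j k = G i k j"
    and chern: "\<And>i j k. dg k i j = (\<Sum>l\<in>UNIV. g l j * G l i k) + (\<Sum>l\<in>UNIV. g i l * G l j k)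
      + 2 * (\<Sum>l\<in>UNIV. C i j l * (N l k / F))"
    and gam: "\<And>i j k. gam i j k = 1/2 * (\<Sum>s\<in>UNIV. gi i s * (dg k s j - dg s j k + dg j s k))"
    and Cu: "\<And>i j k. Cu i j k = (\<Sum>l\<in>UNIV. gi i l * C l j k)"
    and N: "\<And>i j. N i j = (\<Sum>k\<in>UNIV. gam i j k * y k)
      - (\<Sum>k\<in>UNIV. \<Sum>r\<in>UNIV. \<Sum>s\<in>UNIV. Cu i j k * gam k r s * (y r * y s / F))"
  shows "N i j = (\<Sum>k\<in>UNIV. G i j k * y k)"
proof -
  define P where "P = (\<lambda>l k. N l k / F)"
  define M where "M = (\<lambda>l. \<Sum>k\<in>UNIV. P l k * y k)"
  define q where "q = (\<lambda>i. \<Sum>r\<in>UNIV. (\<Sum>s\<in>UNIV. gam i r s * y s) * y r)"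
  have Cy2: "(\<Sum>k\<in>UNIV. C i k l * y k) = 0" for i l
    using Cy[of i l] by (subst Csym) simp
  have Cuy: "(\<Sum>r\<in>UNIV. Cu i r l * y r) = 0" for i l
  proof -
    have "(\<Sum>r\<in>UNIV. Cu i r l * y r) = (\<Sum>r\<in>UNIV. \<Sum>s\<in>UNIV. gi i s * (C s r l * y r))"
      by (simp add: Cu sum_distrib_right mult.assoc)
    also have "\<dots> = (\<Sum>s\<in>UNIV. gi i s * (\<Sum>r\<in>UNIV. C s r l * y r))"
      by (subst sum.swap) (simp add: sum_distrib_left)
    finally show ?thesis by (simp add: Cy2)
  qed
  have CN: "(\<Sum>k\<in>UNIV. (\<Sum>l\<in>UNIV. C a k l * P l b) * y k) = 0" for a b
  proof -
    have "(\<Sum>k\<in>UNIV. (\<Sum>l\<in>UNIV. C a k l * P l b) * y k)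
        = (\<Sum>k\<in>UNIV. \<Sum>l\<in>UNIV. (C a k l * y k) * P l b)"
      unfolding sum_distrib_right by (simp add: mult_ac)
    also have "\<dots> = (\<Sum>l\<in>UNIV. (\<Sum>k\<in>UNIV. C a k l * y k) * P l b)"
      by (subst sum.swap) (simp only: sum_distrib_right)
    finally show ?thesis by (simp add: Cy2)
  qed
  \<comment> \<open>The Christoffel combination: by the symmetries of \<open>g\<close> and
    \<open>G\<close>, four of the six connection terms cancel and the other two coincide. The three
    Cartan terms stay; two of them have a metric index in the slot to be contracted with
    \<open>y\<close>.\<close>
  have low: "dg k s j - dg s j k + dg j s k = 2 * (\<Sum>l\<in>UNIV. g s l * G l j k)
      + 2 * (\<Sum>l\<in>UNIV. C s j l * P l k) - 2 * (\<Sum>l\<in>UNIV. C j k l * P l s)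
      + 2 * (\<Sum>l\<in>UNIV. C s k l * P l j)" for k s j
  proof -
    have "(\<Sum>l\<in>UNIV. g l j * G l s k) = (\<Sum>l\<in>UNIV. g j l * G l k s)"
      "(\<Sum>l\<in>UNIV. g l k * G l s j) = (\<Sum>l\<in>UNIV. g l k * G l j s)"
      "(\<Sum>l\<in>UNIV. g s l * G l k j) = (\<Sum>l\<in>UNIV. g s l * G l j k)"
      using gsym Gsym by (metis (no_types, lifting))+
    then show ?thesis unfolding chern by (simp add: P_def)
  qed
  have lowy: "(\<Sum>k\<in>UNIV. (dg k s j - dg s j k + dg j s k) * y k)
      = 2 * (\<Sum>l\<in>UNIV. g s l * (\<Sum>k\<in>UNIV. G l j k * y k)) + 2 * (\<Sum>l\<in>UNIV. C s j l * M l)"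
    for s j
  proof -
    have "(\<Sum>k\<in>UNIV. (dg k s j - dg s j k + dg j s k) * y k)
        = 2 * (\<Sum>k\<in>UNIV. (\<Sum>l\<in>UNIV. g s l * G l j k) * y k)
        + 2 * (\<Sum>k\<in>UNIV. (\<Sum>l\<in>UNIV. C s j l * P l k) * y k)
        - 2 * (\<Sum>k\<in>UNIV. (\<Sum>l\<in>UNIV. C j k l * P l s) * y k)
        + 2 * (\<Sum>k\<in>UNIV. (\<Sum>l\<in>UNIV. C s k l * P l j) * y k)"
      by (simp only: low distrib_right left_diff_distrib sum.distrib sum_subtractf mult.assoc
          sum_distrib_left[symmetric])
    also have "(\<Sum>k\<in>UNIV. (\<Sum>l\<in>UNIV. g s l * G l j k) * y k)
        = (\<Sum>l\<in>UNIV. g s l * (\<Sum>k\<in>UNIV. G l j k * y k))"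
      unfolding sum_distrib_left sum_distrib_right by (subst sum.swap) (simp add: mult.assoc)
    also have "(\<Sum>k\<in>UNIV. (\<Sum>l\<in>UNIV. C s j l * P l k) * y k) = (\<Sum>l\<in>UNIV. C s j l * M l)"
      unfolding M_def sum_distrib_left sum_distrib_right by (subst sum.swap) (simp add: mult.assoc)
    finally show ?thesis by (simp add: CN)
  qed
  have gamy: "(\<Sum>k\<in>UNIV. gam i j k * y k) = (\<Sum>k\<in>UNIV. G i j k * y k) + (\<Sum>l\<in>UNIV. Cu i j l * M l)"
    for i j
  proof -
    have "(\<Sum>k\<in>UNIV. gam i j k * y k)
        = 1/2 * (\<Sum>k\<in>UNIV. \<Sum>s\<in>UNIV. gi i s * ((dg k s j - dg s j k + dg j s k) * y k))"
      unfolding gam sum_distrib_left sum_distrib_right by (simp add: mult.assoc)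
    also have "\<dots> = 1/2 * (\<Sum>s\<in>UNIV. gi i s * (\<Sum>k\<in>UNIV. (dg k s j - dg s j k + dg j s k) * y k))"
      unfolding sum_distrib_left by (subst sum.swap) simp
    also have "\<dots> = (\<Sum>s\<in>UNIV. gi i s * (\<Sum>l\<in>UNIV. g s l * (\<Sum>k\<in>UNIV. G l j k * y k)))
        + (\<Sum>s\<in>UNIV. gi i s * (\<Sum>l\<in>UNIV. C s j l * M l))"
      by (simp add: lowy distrib_left sum.distrib mult.left_commute[of _ 2] sum_distrib_left[symmetric])
    also have "(\<Sum>s\<in>UNIV. gi i s * (\<Sum>l\<in>UNIV. g s l * (\<Sum>k\<in>UNIV. G l j k * y k)))
        = (\<Sum>l\<in>UNIV. (\<Sum>s\<in>UNIV. gi i s * g s l) * (\<Sum>k\<in>UNIV. G l j k * y k))"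
      by (rule sum_mult_sum_assoc)
    also have "\<dots> = (\<Sum>k\<in>UNIV. G i j k * y k)"
      unfolding inv by (simp add: if_distrib[of "\<lambda>x. x * _"] cong: if_cong)
    also have "(\<Sum>s\<in>UNIV. gi i s * (\<Sum>l\<in>UNIV. C s j l * M l)) = (\<Sum>l\<in>UNIV. Cu i j l * M l)"
      unfolding Cu by (rule sum_mult_sum_assoc)
    finally show ?thesis .
  qed
  have Nq: "N i j = (\<Sum>k\<in>UNIV. gam i j k * y k) - (\<Sum>k\<in>UNIV. Cu i j k * (q k / F))" for i j
  proof -
    have "(\<Sum>r\<in>UNIV. \<Sum>s\<in>UNIV. Cu i j k * gam k r s * (y r * y s / F)) = Cu i j k * (q k / F)" for k
      unfolding q_def sum_divide_distrib sum_distrib_left sum_distrib_right by (simp add: mult_ac)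
    then show ?thesis unfolding N by simp
  qed
  \<comment> \<open>This closes the circle: contracting the definition of \<open>N\<close> with
    \<open>y\<close> kills its Cartan correction, so \<open>N y\<close> equals
    \<open>gam y y\<close> without any use of the Chern equation.\<close>
  have "M l = q l / F" for l
  proof -
    have "M l = (\<Sum>j\<in>UNIV. N l j * y j) / F"
      unfolding M_def P_def sum_divide_distrib by simp
    also have "(\<Sum>j\<in>UNIV. N l j * y j) = q l - (\<Sum>j\<in>UNIV. (\<Sum>k\<in>UNIV. Cu l j k * (q k / F)) * y j)"
      unfolding Nq left_diff_distrib sum_subtractf by (simp add: q_def)
    also have "(\<Sum>j\<in>UNIV. (\<Sum>k\<in>UNIV. Cu l j k * (q k / F)) * y j)
        = (\<Sum>k\<in>UNIV. (\<Sum>j\<in>UNIV. Cu l j k * y j) * (q k / F))"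
      unfolding sum_distrib_right by (subst sum.swap) (simp add: mult_ac)
    finally show ?thesis by (simp add: Cuy)
  qed
  then show ?thesis by (simp add: Nq gamy)
qed

text \<open>Testing \<open>torsion_free_at\<close> on an \<open>x\<close>-direction and a
  \<open>y\<close>-direction shows that the forms have no \<open>dy\<close> part; testing it on two
  \<open>x\<close>-directions gives the symmetry of the lower indices.\<close>

lemma torsion_free_at_fst:
  fixes \<omega> :: "((real^'n) \<times> (real^'n), 'n::finite) conn_form"
  assumes "linear (\<omega> z)" "torsion_free_at fst \<omega> z"
  shows "\<omega> z (u, v) = \<omega> z (u, 0)"
    and "\<omega> z (axis k 1, 0) $ i $ j = \<omega> z (axis j 1, 0) $ i $ k"
proof -
  have t: "(\<Sum>j\<in>UNIV. fst \<zeta> $ j * \<omega> z \<zeta>' $ i $ j) = (\<Sum>j\<in>UNIV. fst \<zeta>' $ j * \<omega> z \<zeta> $ i $ j)" for i \<zeta> \<zeta>'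
    using assms(2)[unfolded torsion_free_at_def sum_subtractf, rule_format, of \<zeta> \<zeta>' i] by simp
  have ax: "(\<Sum>j\<in>UNIV. axis k 1 $ j * c j) = c k" for k and c :: "'n \<Rightarrow> real"
    by (simp add: axis_def if_distrib[of "\<lambda>x. x * _"] cong: if_cong)
  have "\<omega> z (0, v) $ i $ k = 0" for i k
    using t[where \<zeta> = "(axis k 1, 0)" and \<zeta>' = "(0, v)" and i = i] by (simp add: ax)
  then have "\<omega> z (0, v) = 0" by (simp add: vec_eq_iff)
  moreover have "\<omega> z (u, v) = \<omega> z (u, 0) + \<omega> z (0, v)"
    using linear_add[OF assms(1), of "(u, 0)" "(0, v)"] by simp
  ultimately show "\<omega> z (u, v) = \<omega> z (u, 0)" by simp
  show "\<omega> z (axis k 1, 0) $ i $ j = \<omega> z (axis j 1, 0) $ i $ k"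
    using t[where \<zeta> = "(axis j 1, 0)" and \<zeta>' = "(axis k 1, 0)" and i = i] by (simp add: ax)
qed

lemma linear_sum_axis:
  fixes f :: "real^'n::finite \<Rightarrow> 'b::real_vector"
  assumes "linear f"
  shows "f v = (\<Sum>i\<in>UNIV. v $ i *\<^sub>R f (axis i 1))"
proof -
  have "v = (\<Sum>i\<in>UNIV. v $ i *\<^sub>R axis i 1)"
    using basis_expansion[of v] by (simp add: scalar_mult_eq_scaleR)
  then have "f v = f (\<Sum>i\<in>UNIV. v $ i *\<^sub>R axis i 1)" by simp
  then show ?thesis by (simp add: linear_sum[OF assms] linear_scale[OF assms])
qed

section \<open>A Finsler function in one chart: homogeneity and its consequences\<close>

locale local_finsler =
  fixes U :: "(real^'n::finite) set" and L :: "real^'n \<Rightarrow> real^'n \<Rightarrow> real"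
  assumes openU: "open U"
    and smoothL: "smooth_on (U \<times> (-{0})) (\<lambda>(x, y). L x y)"
    and homogeneous: "\<And>x y a. x \<in> U \<Longrightarrow> a > 0 \<Longrightarrow> L x (a *\<^sub>R y) = a * L x y"
    and posdef: "\<And>x y v. x \<in> U \<Longrightarrow> y \<noteq> 0 \<Longrightarrow> v \<noteq> 0 \<Longrightarrow> v \<bullet> (fund L x y *v v) > 0"
begin

abbreviation "S \<equiv> U \<times> (- {0 :: real^'n})"

text \<open>\<open>E\<close>, \<open>DE\<close> and \<open>g\<close> restate the square of
  \<open>L\<close>, its vertical gradient and the fundamental tensor by Frechet derivatives on the
  product of position and direction, where the results on smooth functions apply;
  \<open>fund\<close> itself nests one-variable derivatives.\<close>

definition "E = (\<lambda>z. (L (fst z) (snd z))\<^sup>2)"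
definition "DE i = (\<lambda>z. frechet_derivative E (at z) (0, axis i 1))"
definition "g i j = (\<lambda>z. 1/2 * frechet_derivative (DE j) (at z) (0, axis i 1))"

lemma open_S: "open S"
  by (intro open_Times openU) auto

lemma smooth_E: "smooth_on S E"
  using smooth_on_mult[OF open_S smoothL smoothL] by (simp add: E_def power2_eq_square case_prod_unfold)

lemma smooth_DE: "smooth_on S (DE i)"
  unfolding DE_def by (rule smooth_on_frechet_derivative[OF smooth_E])

lemma E_deriv: "z \<in> S \<Longrightarrow> (E has_derivative frechet_derivative E (at z)) (at z)"
  by (rule smooth_on_has_derivative[OF smooth_E])

lemma DE_deriv: "z \<in> S \<Longrightarrow> (DE i has_derivative frechet_derivative (DE i) (at z)) (at z)"
  by (rule smooth_on_has_derivative[OF smooth_DE])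

lemma g_deriv: "z \<in> S \<Longrightarrow> (g i j has_derivative frechet_derivative (g i j) (at z)) (at z)"
proof -
  assume z: "z \<in> S"
  have "smooth_on S (\<lambda>z. frechet_derivative (DE j) (at z) (0, axis i 1))"
    by (rule smooth_on_frechet_derivative[OF smooth_DE])
  from smooth_on_has_derivative[OF this z]
  have "g i j differentiable (at z)"
    unfolding g_def by (intro differentiable_mult) (auto simp: differentiable_def)
  then show ?thesis by (rule has_derivative_frechet)
qed

lemma g_sym: "z \<in> S \<Longrightarrow> g i j z = g j i z"
  using second_derivative_commute[OF open_S _ smooth_E] by (simp add: g_def DE_def)

lemma vertical:
  assumes "(f has_derivative f') (at (x, y))"
  shows "((\<lambda>y. f (x, y)) has_derivative (\<lambda>v. f' (0, v))) (at y)"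
proof -
  have "((\<lambda>y. (x, y)) has_derivative (\<lambda>v. (0, v))) (at y)" by (auto intro!: derivative_eq_intros)
  from has_derivative_compose[OF this assms] show ?thesis .
qed

lemma horizontal:
  assumes "(f has_derivative f') (at (x, y))"
  shows "((\<lambda>x. f (x, y)) has_derivative (\<lambda>u. f' (u, 0))) (at x)"
proof -
  have "((\<lambda>x. (x, y)) has_derivative (\<lambda>u. (u, 0))) (at x)" by (auto intro!: derivative_eq_intros)
  from has_derivative_compose[OF this assms] show ?thesis .
qed

lemma partial_sq: "(x, y) \<in> S \<Longrightarrow> partial j (\<lambda>y. (L x y)\<^sup>2) y = DE j (x, y)"
  using partial_eq[OF vertical[OF E_deriv]] by (simp add: DE_def E_def)

text \<open>The inner derivative in \<open>fund\<close> is known to be \<open>DE j\<close> only for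
  \<open>y \<noteq> 0\<close>. This is an open condition, which suffices for differentiating once
  more.\<close>

lemma fund_eq:
  assumes "(x, y) \<in> S"
  shows "fund L x y $ i $ j = g i j (x, y)"
proof -
  have "((\<lambda>y. partial j (\<lambda>y. (L x y)\<^sup>2) y) has_derivative
      (\<lambda>v. frechet_derivative (DE j) (at (x, y)) (0, v))) (at y)"
    by (rule has_derivative_transform_within_open[OF vertical[OF DE_deriv[OF assms]], of "-{0}"])
       (use assms in \<open>auto simp: partial_sq\<close>)
  from partial_eq[OF this] show ?thesis by (simp add: fund_def g_def)
qed

lemma fund_deriv:
  assumes "(x, y) \<in> S"
  shows "((\<lambda>z. (case z of (x, y) \<Rightarrow> fund L x y) $ i $ j) has_derivative
    frechet_derivative (g i j) (at (x, y))) (at (x, y))"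
proof (rule has_derivative_transform_within_open[OF g_deriv[OF assms] open_S assms])
  show "g i j z = (case z of (x, y) \<Rightarrow> fund L x y) $ i $ j" if "z \<in> S" for z
    using that by (cases z) (simp add: fund_eq)
qed

lemma partial_fund:
  assumes "(x, y) \<in> S"
  shows "partial k (\<lambda>y. fund L x y $ i $ j) y = frechet_derivative (g i j) (at (x, y)) (0, axis k 1)"
    and "partial k (\<lambda>x. fund L x y $ i $ j) x = frechet_derivative (g i j) (at (x, y)) (axis k 1, 0)"
  using partial_eq[OF vertical[OF fund_deriv[OF assms]]] partial_eq[OF horizontal[OF fund_deriv[OF assms]]]
  by simp_all

text \<open>Both sides are the derivative at \<open>t = 0\<close> of
  \<open>E (x, y + t y) = (1 + t)^2 E (x, y)\<close>. Homogeneity holds for positive factors only,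
  hence the restriction to \<open>t > -1\<close>.\<close>

lemma Euler:
  assumes z: "(x, y) \<in> S"
  shows "(\<Sum>i\<in>UNIV. y $ i * DE i (x, y)) = 2 * E (x, y)"
proof -
  have lin: "linear (\<lambda>v. frechet_derivative E (at (x, y)) (0, v))"
    using has_derivative_linear[OF vertical[OF E_deriv[OF z]]] .
  have "((\<lambda>t. E (x, y + t *\<^sub>R y)) has_real_derivative frechet_derivative E (at (x, y)) (0, y)) (at 0)"
    by (rule DERIV_along_line[where f = "\<lambda>y. E (x, y)"]) (use vertical[OF E_deriv[OF z]] in simp)
  moreover have "((\<lambda>t. E (x, y + t *\<^sub>R y)) has_real_derivative 2 * E (x, y)) (at 0)"
  proof -
    have "((\<lambda>t. (1 + t)\<^sup>2 * E (x, y)) has_real_derivative 2 * E (x, y)) (at 0)"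
      by (auto intro!: derivative_eq_intros)
    then show ?thesis
    proof (rule has_field_derivative_transform_within_open[where S = "{-1<..}"])
      fix t :: real assume "t \<in> {-1<..}"
      then have "L x (y + t *\<^sub>R y) = (1 + t) * L x y"
        using homogeneous[of x "1 + t" y] z by (simp add: scaleR_add_left)
      then show "(1 + t)\<^sup>2 * E (x, y) = E (x, y + t *\<^sub>R y)" by (simp add: E_def power_mult_distrib)
    qed auto
  qed
  ultimately have "frechet_derivative E (at (x, y)) (0, y) = 2 * E (x, y)"
    by (rule DERIV_unique)
  then show ?thesis by (subst (asm) linear_sum_axis[OF lin]) (simp add: DE_def)
qed

text \<open>Euler's identity differentiated once on the product space: a vertical direction gives
  the first claim, an \<open>x\<close>-direction the second.\<close>

lemma DE_eq:
  assumes z: "(x, y) \<in> S"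
  shows "DE j (x, y) = 2 * (\<Sum>i\<in>UNIV. g j i (x, y) * y $ i)"
    and "2 * frechet_derivative E (at (x, y)) (u, 0) =
      (\<Sum>i\<in>UNIV. y $ i * frechet_derivative (DE i) (at (x, y)) (u, 0))"
proof -
  have D1: "((\<lambda>z. \<Sum>i\<in>UNIV. snd z $ i * DE i z) has_derivative
     (\<lambda>\<zeta>. \<Sum>i\<in>UNIV. y $ i * frechet_derivative (DE i) (at (x, y)) \<zeta> + snd \<zeta> $ i * DE i (x, y))) (at (x, y))"
    by (auto intro!: derivative_eq_intros DE_deriv[OF z] bounded_linear.has_derivative[OF bounded_linear_vec_nth])
  have D2: "((\<lambda>z. \<Sum>i\<in>UNIV. snd z $ i * DE i z) has_derivative
     (\<lambda>\<zeta>. 2 * frechet_derivative E (at (x, y)) \<zeta>)) (at (x, y))"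
  proof (rule has_derivative_transform_within_open[OF _ open_S z, where f = "\<lambda>z. 2 * E z"])
    show "2 * E z = (\<Sum>i\<in>UNIV. snd z $ i * DE i z)" if "z \<in> S" for z
      using that Euler[of "fst z" "snd z"] by simp
  qed (auto intro!: derivative_eq_intros E_deriv[OF z])
  have *: "(\<Sum>i\<in>UNIV. y $ i * frechet_derivative (DE i) (at (x, y)) \<zeta> + snd \<zeta> $ i * DE i (x, y))
      = 2 * frechet_derivative E (at (x, y)) \<zeta>" for \<zeta>
    by (rule fun_cong[OF has_derivative_unique[OF D1 D2]])
  show "2 * frechet_derivative E (at (x, y)) (u, 0) =
      (\<Sum>i\<in>UNIV. y $ i * frechet_derivative (DE i) (at (x, y)) (u, 0))"
    using *[of "(u, 0)"] by simp
  have "(\<Sum>i\<in>UNIV. axis j 1 $ i * DE i (x, y)) = DE j (x, y)"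
    by (simp add: axis_def if_distrib[of "\<lambda>x. x * _"] cong: if_cong)
  moreover have "frechet_derivative (DE i) (at (x, y)) (0, axis j 1) = 2 * g j i (x, y)" for i
    by (simp add: g_def)
  ultimately show "DE j (x, y) = 2 * (\<Sum>i\<in>UNIV. g j i (x, y) * y $ i)"
    using *[of "(0, axis j 1)"]
    by (simp add: sum.distrib DE_def[symmetric] sum_distrib_left mult_ac)
      (simp add: DE_def)
qed

lemma DE_deriv_eq:
  assumes z: "(x, y) \<in> S"
  shows "frechet_derivative (DE j) (at (x, y)) \<zeta> =
    2 * (\<Sum>i\<in>UNIV. frechet_derivative (g j i) (at (x, y)) \<zeta> * y $ i + g j i (x, y) * snd \<zeta> $ i)"
proof -
  have "((\<lambda>z. 2 * (\<Sum>i\<in>UNIV. g j i z * snd z $ i)) has_derivative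
    (\<lambda>\<zeta>. 2 * (\<Sum>i\<in>UNIV. frechet_derivative (g j i) (at (x, y)) \<zeta> * y $ i + g j i (x, y) * snd \<zeta> $ i)))
    (at (x, y))"
    by (auto intro!: derivative_eq_intros g_deriv[OF z] bounded_linear.has_derivative[OF bounded_linear_vec_nth]
        simp: add.commute)
  then have "(DE j has_derivative
    (\<lambda>\<zeta>. 2 * (\<Sum>i\<in>UNIV. frechet_derivative (g j i) (at (x, y)) \<zeta> * y $ i + g j i (x, y) * snd \<zeta> $ i)))
    (at (x, y))"
  proof (rule has_derivative_transform_within_open[OF _ open_S z])
    show "2 * (\<Sum>i\<in>UNIV. g j i z * snd z $ i) = DE j z" if "z \<in> S" for z
      using that DE_eq(1)[of "fst z" "snd z"] by simp
  qed
  from frechet_derivative_eq[OF this] show ?thesis by simp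
qed

text \<open>Differentiating \<open>DE j = 2 g_ji y^i\<close> vertically gives \<open>2 g_kj\<close>
  on one side and \<open>2 g_jk\<close> plus twice the sum in question on the other. Symmetry of
  \<open>g\<close>, that is, of the second derivatives of \<open>E\<close>, leaves zero. The
  contraction is over a metric index, so total symmetry of the Cartan tensor does not have to be
  established.\<close>

lemma g_deriv_vertical:
  assumes z: "(x, y) \<in> S"
  shows "(\<Sum>i\<in>UNIV. frechet_derivative (g j i) (at (x, y)) (0, axis k 1) * y $ i) = 0"
proof -
  have "2 * g k j (x, y) =
    2 * (\<Sum>i\<in>UNIV. frechet_derivative (g j i) (at (x, y)) (0, axis k 1) * y $ i) + 2 * g j k (x, y)"
    using DE_deriv_eq[OF z, of j "(0, axis k 1)"]
    by (simp add: g_def sum.distrib axis_def if_distrib[of "\<lambda>x. _ * x"] cong: if_cong)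
  then show ?thesis using g_sym[OF z] by simp
qed

lemma E_deriv_horizontal:
  assumes z: "(x, y) \<in> S"
  shows "frechet_derivative E (at (x, y)) (u, 0) =
    (\<Sum>i\<in>UNIV. \<Sum>j\<in>UNIV. frechet_derivative (g i j) (at (x, y)) (u, 0) * y $ i * y $ j)"
proof -
  have "2 * frechet_derivative E (at (x, y)) (u, 0) =
    2 * (\<Sum>i\<in>UNIV. \<Sum>j\<in>UNIV. frechet_derivative (g i j) (at (x, y)) (u, 0) * y $ i * y $ j)"
    unfolding DE_eq(2)[OF z] DE_deriv_eq[OF z] by (simp add: sum_distrib_left mult_ac)
  then show ?thesis by simp
qed

text \<open>Euler's identity gives \<open>L^2 = g_ij y^i y^j\<close>, which is positive by
  definiteness, whereas a Finsler structure only demands nonnegative values. It permits the return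
  from derivatives of \<open>E\<close> to derivatives of \<open>L\<close>.\<close>

lemma L_nonzero:
  assumes z: "(x, y) \<in> S"
  shows "L x y \<noteq> 0"
proof -
  have "y \<bullet> (fund L x y *v y) = (\<Sum>i\<in>UNIV. y $ i * (\<Sum>j\<in>UNIV. g i j (x, y) * y $ j))"
    by (simp add: inner_vec_def matrix_vector_mult_def fund_eq[OF z])
  also have "\<dots> = E (x, y)"
    using Euler[OF z] unfolding DE_eq(1)[OF z] by (simp add: sum_distrib_left[symmetric] mult.left_commute[of _ 2])
  finally show ?thesis using posdef[of x y y] z by (auto simp: E_def)
qed

section \<open>Contracting the structure equation of the Chern connection\<close>

lemma chern_equation:
  assumes z: "(x, y) \<in> S"
    and chern: "\<And>\<zeta> i j. cov_deriv_metric \<omega> (\<lambda>(x, y). fund L x y) (x, y) \<zeta> i j =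
             2 * (\<Sum>k\<in>UNIV. cartan L x y i j k * (delta_y L x y k \<zeta> / L x y))"
  shows "frechet_derivative (g i j) (at (x, y)) \<zeta> =
     (\<Sum>l\<in>UNIV. g l j (x, y) * \<omega> (x, y) \<zeta> $ l $ i) + (\<Sum>l\<in>UNIV. g i l (x, y) * \<omega> (x, y) \<zeta> $ l $ j)
     + 2 * (\<Sum>k\<in>UNIV. cartan L x y i j k * (delta_y L x y k \<zeta> / L x y))"
proof -
  have "frechet_derivative (\<lambda>z. (case z of (x, y) \<Rightarrow> fund L x y) $ i $ j) (at (x, y))
      = frechet_derivative (g i j) (at (x, y))"
    by (rule frechet_derivative_eq[OF fund_deriv[OF z]])
  then show ?thesis using chern[of \<zeta> i j] by (simp add: cov_deriv_metric_def fund_eq[OF z])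
qed

lemma cartan_eq:
  "(x, y) \<in> S \<Longrightarrow> cartan L x y i j k = L x y / 2 * frechet_derivative (g i j) (at (x, y)) (0, axis k 1)"
  by (simp add: cartan_def partial_fund)

lemma frechet_g_sym:
  assumes z: "z \<in> S"
  shows "frechet_derivative (g i j) (at z) = frechet_derivative (g j i) (at z)"
  by (rule frechet_derivative_eq)
     (rule has_derivative_transform_within_open[OF g_deriv[OF z] open_S z], rule g_sym)

lemma cartan_sym: "(x, y) \<in> S \<Longrightarrow> cartan L x y i j k = cartan L x y j i k"
  by (simp add: cartan_eq frechet_g_sym[of _ i j])

lemma cartan_y:
  assumes z: "(x, y) \<in> S"
  shows "(\<Sum>j\<in>UNIV. cartan L x y i j k * y $ j) = 0"
  by (simp only: cartan_eq[OF z] mult.assoc sum_distrib_left[symmetric] g_deriv_vertical[OF z] mult_zero_right)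

lemma nonlin_conn_eq:
  assumes z: "(x, y) \<in> S"
    and lin: "linear (\<omega> (x, y))" and tf: "torsion_free_at fst \<omega> (x, y)"
    and chern: "\<And>\<zeta> i j. cov_deriv_metric \<omega> (\<lambda>(x, y). fund L x y) (x, y) \<zeta> i j =
             2 * (\<Sum>k\<in>UNIV. cartan L x y i j k * (delta_y L x y k \<zeta> / L x y))"
  shows "nonlin_conn L x y i j = (\<Sum>k\<in>UNIV. conn_coeff \<omega> x y i j k * y $ k)"
proof (rule nonlinear_connection_identity)
  show "(\<Sum>s\<in>UNIV. fund_inv L x y $ i $ s * g s j (x, y)) = (if i = j then 1 else 0)" for i j
  proof -
    have "(fund_inv L x y ** fund L x y) $ i $ j = (mat 1 :: real^'n^'n) $ i $ j"
      unfolding fund_inv_def using pos_def_matrix_inv[of "fund L x y"] posdef[of x y] z by simp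
    then show ?thesis by (simp add: matrix_matrix_mult_def fund_eq[OF z] mat_def)
  qed
  show "g i j (x, y) = g j i (x, y)" for i j by (rule g_sym[OF z])
  show "cartan L x y i j k = cartan L x y j i k" for i j k by (rule cartan_sym[OF z])
  show "(\<Sum>i\<in>UNIV. cartan L x y i j k * y $ i) = 0" for j k
    using cartan_y[OF z, of j k] cartan_sym[OF z] by simp
  show "conn_coeff \<omega> x y i j k = conn_coeff \<omega> x y i k j" for i j k
    unfolding conn_coeff_def by (rule torsion_free_at_fst(2)[OF lin tf])
  show "frechet_derivative (g i j) (at (x, y)) (axis k 1, 0) =
      (\<Sum>l\<in>UNIV. g l j (x, y) * conn_coeff \<omega> x y l i k) + (\<Sum>l\<in>UNIV. g i l (x, y) * conn_coeff \<omega> x y l j k)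
      + 2 * (\<Sum>l\<in>UNIV. cartan L x y i j l * (nonlin_conn L x y l k / L x y))" for i j k
  proof -
    have "delta_y L x y l (axis k 1, 0) = nonlin_conn L x y l k" for l
      by (simp add: delta_y_def axis_def if_distrib[of "\<lambda>x. _ * x"] cong: if_cong)
    then show ?thesis
      using chern_equation[OF z chern, of i j "(axis k 1, 0)"] by (simp add: conn_coeff_def)
  qed
  show "formal_christoffel L x y i j k = 1/2 * (\<Sum>s\<in>UNIV. fund_inv L x y $ i $ s *
      (frechet_derivative (g s j) (at (x, y)) (axis k 1, 0)
       - frechet_derivative (g j k) (at (x, y)) (axis s 1, 0)
       + frechet_derivative (g s k) (at (x, y)) (axis j 1, 0)))" for i j k
    unfolding formal_christoffel_def partial_fund[OF z] ..
  show "cartan_up L x y i j k = (\<Sum>l\<in>UNIV. fund_inv L x y $ i $ l * cartan L x y l j k)" for i j k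
    by (rule cartan_up_def)
  show "nonlin_conn L x y i j = (\<Sum>k\<in>UNIV. formal_christoffel L x y i j k * y $ k)
     - (\<Sum>k\<in>UNIV. \<Sum>r\<in>UNIV. \<Sum>s\<in>UNIV.
          cartan_up L x y i j k * formal_christoffel L x y k r s * (y $ r * y $ s / L x y))" for i j
    by (rule nonlin_conn_def)
qed

text \<open>With \<open>w = \<omega>(u) y\<close>, contracting the Chern equation twice with
  \<open>y\<close> gives \<open>dE(u, 0) = 2 g(y, w)\<close>, and the formula for \<open>DE\<close>
  gives \<open>dE(0, w) = 2 g(y, w)\<close>. Hence \<open>dE(u, -w) = 0\<close>, and
  \<open>dE = 2 L dL\<close> with \<open>L \<noteq> 0\<close> yields the claim.\<close>

lemma horizontal_derivative_zero:
  assumes z: "(x, y) \<in> S"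
    and chern: "\<And>\<zeta> i j. cov_deriv_metric \<omega> (\<lambda>(x, y). fund L x y) (x, y) \<zeta> i j =
             2 * (\<Sum>k\<in>UNIV. cartan L x y i j k * (delta_y L x y k \<zeta> / L x y))"
  shows "frechet_derivative (\<lambda>(x, y). L x y) (at (x, y)) (u, - (\<omega> (x, y) (u, 0) *v y)) = 0"
proof -
  define W where "W = \<omega> (x, y) (u, 0)"
  define w where "w = W *v y"
  \<comment> \<open>The Cartan term vanishes whatever it is paired with, so the form
    \<open>delta_y\<close> never has to be evaluated.\<close>
  have C: "(\<Sum>i\<in>UNIV. \<Sum>j\<in>UNIV. 2 * (\<Sum>k\<in>UNIV. cartan L x y i j k * c k) * y $ i * y $ j) = 0" for c
  proof -
    have "(\<Sum>j\<in>UNIV. (\<Sum>k\<in>UNIV. cartan L x y i j k * c k) * y $ j)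
        = (\<Sum>k\<in>UNIV. c k * (\<Sum>j\<in>UNIV. cartan L x y i j k * y $ j))" for i
      unfolding sum_distrib_left sum_distrib_right by (subst sum.swap) (simp add: mult_ac)
    then have 0: "(\<Sum>j\<in>UNIV. (\<Sum>k\<in>UNIV. cartan L x y i j k * c k) * y $ j) = 0" for i
      by (simp add: cartan_y[OF z])
    have "(\<Sum>i\<in>UNIV. \<Sum>j\<in>UNIV. 2 * Q i j * y $ i * y $ j)
       = (\<Sum>i\<in>UNIV. 2 * y $ i * (\<Sum>j\<in>UNIV. Q i j * y $ j))" for Q :: "'n \<Rightarrow> 'n \<Rightarrow> real"
      by (simp add: sum_distrib_left mult_ac)
    then show ?thesis by (simp add: 0)
  qed
  have w: "w $ l = (\<Sum>i\<in>UNIV. W $ l $ i * y $ i)" for l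
    by (simp add: w_def matrix_vector_mult_def)
  have A: "(\<Sum>i\<in>UNIV. \<Sum>j\<in>UNIV. (\<Sum>l\<in>UNIV. g i l (x, y) * W $ l $ j) * y $ i * y $ j)
      = (\<Sum>i\<in>UNIV. \<Sum>l\<in>UNIV. y $ i * g i l (x, y) * w $ l)"
  proof (rule sum.cong[OF refl])
    fix i
    have "(\<Sum>j\<in>UNIV. (\<Sum>l\<in>UNIV. g i l (x, y) * W $ l $ j) * y $ i * y $ j)
        = (\<Sum>j\<in>UNIV. \<Sum>l\<in>UNIV. y $ i * g i l (x, y) * (W $ l $ j * y $ j))"
      unfolding sum_distrib_right by (simp add: mult_ac)
    also have "\<dots> = (\<Sum>l\<in>UNIV. y $ i * g i l (x, y) * w $ l)"
      unfolding w sum_distrib_left by (rule sum.swap)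
    finally show "(\<Sum>j\<in>UNIV. (\<Sum>l\<in>UNIV. g i l (x, y) * W $ l $ j) * y $ i * y $ j)
        = (\<Sum>l\<in>UNIV. y $ i * g i l (x, y) * w $ l)" .
  qed
  have B: "(\<Sum>i\<in>UNIV. \<Sum>j\<in>UNIV. (\<Sum>l\<in>UNIV. g l j (x, y) * W $ l $ i) * y $ i * y $ j)
      = (\<Sum>i\<in>UNIV. \<Sum>l\<in>UNIV. y $ i * g i l (x, y) * w $ l)"
    unfolding A[symmetric] by (subst sum.swap) (simp add: g_sym[OF z] mult_ac)
  have "frechet_derivative E (at (x, y)) (u, 0) = 2 * (\<Sum>i\<in>UNIV. \<Sum>l\<in>UNIV. y $ i * g i l (x, y) * w $ l)"
    unfolding E_deriv_horizontal[OF z] chern_equation[OF z chern] W_def[symmetric]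
    unfolding distrib_right sum.distrib A B C by simp
  moreover have "frechet_derivative E (at (x, y)) (0, w) = 2 * (\<Sum>i\<in>UNIV. \<Sum>l\<in>UNIV. y $ i * g i l (x, y) * w $ l)"
  proof -
    have "frechet_derivative E (at (x, y)) (0, w) = (\<Sum>l\<in>UNIV. w $ l * DE l (x, y))"
      using linear_sum_axis[OF has_derivative_linear[OF vertical[OF E_deriv[OF z]]], of w]
      by (simp add: DE_def)
    also have "\<dots> = 2 * (\<Sum>l\<in>UNIV. \<Sum>i\<in>UNIV. y $ i * g i l (x, y) * w $ l)"
      unfolding DE_eq(1)[OF z] sum_distrib_left by (simp add: g_sym[OF z] mult_ac)
    finally show ?thesis by (subst sum.swap) simp
  qed
  moreover have "frechet_derivative E (at (x, y)) (u, - w)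
      = frechet_derivative E (at (x, y)) (u, 0) - frechet_derivative E (at (x, y)) (0, w)"
    using linear_diff[OF has_derivative_linear[OF E_deriv[OF z]], of "(u, 0)" "(0, w)"] by simp
  ultimately have 0: "frechet_derivative E (at (x, y)) (u, - w) = 0" by simp
  have "(E has_derivative (\<lambda>\<zeta>. 2 * L x y * frechet_derivative (\<lambda>(x, y). L x y) (at (x, y)) \<zeta>)) (at (x, y))"
    using has_derivative_power[OF smooth_on_has_derivative[OF smoothL z], of 2]
    by (simp add: E_def case_prod_unfold mult_ac)
  from frechet_derivative_eq[OF this] 0 L_nonzero[OF z] show ?thesis
    by (simp add: w_def W_def)
qed

end


section \<open>Charts and tangent vectors\<close>

text \<open>The usual index permutation: the difference of two torsion-free metric connections, with an
  index lowered, is skew in one pair of indices and symmetric in an overlapping one.\<close>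

lemma metric_connection_unique:
  fixes H :: "real^'n^'n" and W W' :: "real^'n::finite \<Rightarrow> real^'n^'n"
  assumes lin: "linear W" "linear W'"
    and sym: "\<And>i j. H $ i $ j = H $ j $ i" and posdef: "\<And>v. v \<noteq> 0 \<Longrightarrow> v \<bullet> (H *v v) > 0"
    and tf: "\<And>i j k. W (axis k 1) $ i $ j = W (axis j 1) $ i $ k"
      "\<And>i j k. W' (axis k 1) $ i $ j = W' (axis j 1) $ i $ k"
    and met: "\<And>u i j. (\<Sum>k\<in>UNIV. H $ k $ j * W u $ k $ i) + (\<Sum>k\<in>UNIV. H $ i $ k * W u $ k $ j) =
      (\<Sum>k\<in>UNIV. H $ k $ j * W' u $ k $ i) + (\<Sum>k\<in>UNIV. H $ i $ k * W' u $ k $ j)"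
  shows "W = W'"
proof -
  define V where "V = (\<lambda>u. W u - W' u)"
  define Q where "Q = (\<lambda>i j l. \<Sum>k\<in>UNIV. H $ i $ k * V (axis l 1) $ k $ j)"
  have Q1: "Q i j l = Q i l j" for i j l
  proof -
    have "V (axis l 1) $ k $ j = V (axis j 1) $ k $ l" for k
      using tf[of l k j] by (simp add: V_def)
    then show ?thesis by (simp add: Q_def)
  qed
  have Q2: "Q j i l = - Q i j l" for i j l
  proof -
    have "Q j i l + Q i j l = 0"
      using met[where u = "axis l 1" and i = i and j = j]
      by (simp add: Q_def V_def sym[of _ j] right_diff_distrib sum_subtractf)
    then show ?thesis by simp
  qed
  \<comment> \<open>Six alternating swaps restore the order of the indices and change the sign three
    times, so \<open>Q\<close> equals its own negative.\<close>
  have "Q i j l = 0" for i j l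
    using Q1[of i j l] Q2[of i l j] Q1[of l i j] Q2[of l j i] Q1[of j l i] Q2[of j i l] by linarith
  then have Q0: "H *v (\<chi> k. V (axis l 1) $ k $ j) = 0" for j l
    by (simp add: Q_def matrix_vector_mult_def vec_eq_iff)
  have V0: "V (axis l 1) = 0" for l
  proof -
    have "(\<chi> k. V (axis l 1) $ k $ j) = 0" for j
      using posdef[of "\<chi> k. V (axis l 1) $ k $ j"] unfolding Q0 by fastforce
    then show ?thesis by (simp add: vec_eq_iff)
  qed
  have "V u = 0" for u
    using linear_sum_axis[OF linear_compose_sub[OF lin], of u] V0 by (simp add: V_def)
  then show ?thesis by (auto simp: V_def)
qed

text \<open>Metric compatibility in matrix form reads \<open>H' = W^T H + H W\<close>, with
  \<open>W\<close> the connection matrix; the identity is its value on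
  \<open>(y, y)\<close>.\<close>

lemma cov_deriv_metric_quadratic:
  fixes H :: "real^'n \<Rightarrow> real^'n::finite^'n"
  assumes dH: "(H has_derivative H') (at x)"
    and met: "\<And>i j. cov_deriv_metric \<omega> H x u i j = 0"
  shows "y \<bullet> (H' u *v y) = (\<omega> x u *v y) \<bullet> (H x *v y) + y \<bullet> (H x *v (\<omega> x u *v y))"
proof -
  have "frechet_derivative (\<lambda>x. H x $ i $ j) (at x) u = H' u $ i $ j" for i j
    using frechet_derivative_eq[OF bounded_linear.has_derivative[OF bounded_linear_vec_nth
          bounded_linear.has_derivative[OF bounded_linear_vec_nth dH]]] by metis
  then have "H' u $ i $ j = (transpose (\<omega> x u) ** H x + H x ** \<omega> x u) $ i $ j" for i j
    using met[of i j] by (simp add: cov_deriv_metric_def matrix_matrix_mult_def transpose_def mult.commute)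
  then have "H' u = transpose (\<omega> x u) ** H x + H x ** \<omega> x u" by (simp add: vec_eq_iff)
  moreover have "y \<bullet> (transpose B *v z) = (B *v y) \<bullet> z" for B :: "real^'n^'n" and z
    using dot_lmul_matrix[of y "transpose B" z] by (simp only: vector_transpose_matrix)
  ultimately show ?thesis
    by (simp only: matrix_vector_mult_add_rdistrib matrix_vector_mul_assoc[symmetric] inner_add_right)
qed

section \<open>Charts of a fixed atlas, Jacobians of transitions and tangent vectors\<close>

locale smooth_atlas =
  fixes T :: "'a topology" and A :: "('a, 'n::finite) chart set"
  assumes manifold: "smooth_manifold T A"
begin

lemma open_cdom: "c \<in> A \<Longrightarrow> openin T (cdom c)"
  and open_cimg: "c \<in> A \<Longrightarrow> open (cimg c)"
  and smooth_transition: "c \<in> A \<Longrightarrow> d \<in> A \<Longrightarrow> smooth_on (overlap c d) (transition c d)"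
  and chart_homeo: "c \<in> A \<Longrightarrow>
    homeomorphic_map (subtopology T (cdom c)) (top_of_set (cimg c)) (cmap c)"
  using manifold by (simp_all add: smooth_manifold_def)

lemma cdom_cover: "(\<Union>c\<in>A. cdom c) = topspace T"
  using manifold by (simp add: smooth_manifold_def)

lemma inj_cmap: "c \<in> A \<Longrightarrow> inj_on (cmap c) (cdom c)"
  using chart_homeo[of c] openin_subset[OF open_cdom, of c]
  by (simp add: homeomorphic_map_def Int_absorb1)

lemma cinv_cmap [simp]: "c \<in> A \<Longrightarrow> p \<in> cdom c \<Longrightarrow> cinv c (cmap c p) = p"
  unfolding cinv_def by (rule inv_into_f_f[OF inj_cmap])

lemma cmap_in_cimg [simp]: "p \<in> cdom c \<Longrightarrow> cmap c p \<in> cimg c"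
  by (simp add: cimg_def)

lemma cmap_cinv [simp]: "x \<in> cimg c \<Longrightarrow> cmap c (cinv c x) = x"
  and cinv_in_cdom [simp]: "x \<in> cimg c \<Longrightarrow> cinv c x \<in> cdom c"
  unfolding cimg_def cinv_def by (auto simp: f_inv_into_f inv_into_into)

lemma overlap_iff: "c \<in> A \<Longrightarrow> p \<in> cdom c \<Longrightarrow> cmap c p \<in> overlap c d \<longleftrightarrow> p \<in> cdom d"
  by (simp add: overlap_def inj_on_image_mem_iff[OF inj_cmap])

lemma transition_cmap: "c \<in> A \<Longrightarrow> p \<in> cdom c \<Longrightarrow> transition c d (cmap c p) = cmap d p"
  by (simp add: transition_def)

lemma open_overlap:
  assumes "c \<in> A" "d \<in> A"
  shows "open (overlap c d)"
proof -
  have "openin (subtopology T (cdom c)) (cdom c \<inter> cdom d)"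
    using open_cdom assms by (metis inf_commute openin_subtopology)
  then have "openin (top_of_set (cimg c)) (cmap c ` (cdom c \<inter> cdom d))"
    using chart_homeo[OF assms(1)] homeomorphic_imp_open_map open_map_def by metis
  then show ?thesis
    unfolding overlap_def using open_cimg[OF assms(1)] openin_open_eq by blast
qed

lemma transition_deriv:
  assumes "c \<in> A" "d \<in> A" "x \<in> overlap c d"
  shows "(transition c d has_derivative (*v) (jac c d x)) (at x)"
proof -
  have "transition c d differentiable (at x)"
    using smooth_on_has_derivative[OF smooth_transition[OF assms(1,2)] assms(3)]
    by (auto simp: differentiable_def)
  then show ?thesis unfolding jac_def using jacobian_works by blast
qed

lemma jac_deriv:
  assumes "c \<in> A" "d \<in> A" "x \<in> overlap c d"
  shows "(jac c d has_derivative frechet_derivative (jac c d) (at x)) (at x)"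
proof (rule has_derivative_frechet)
  have "(\<lambda>x. frechet_derivative (transition c d) (at x) (axis j 1)) differentiable (at x)" for j
    using smooth_on_has_derivative[OF smooth_on_frechet_derivative[OF smooth_transition[OF assms(1,2)]] assms(3)]
    by (auto simp: differentiable_def)
  then have "(\<lambda>x. frechet_derivative (transition c d) (at x) (axis j 1) $ i) differentiable (at x)" for i j
    unfolding differentiable_def using bounded_linear.has_derivative[OF bounded_linear_vec_nth] by blast
  then have "(\<lambda>x. jac c d x $ i $ j) differentiable (at x)" for i j
    by (simp add: jac_def jacobian_def matrix_def)
  then show "jac c d differentiable (at x)"
    by (subst differentiable_componentwise_within) (auto simp: Basis_vec_def inner_axis)
qed

lemma jac_refl:
  assumes "c \<in> A" "x \<in> cimg c"
  shows "jac c c x = mat 1"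
proof -
  have "(transition c c has_derivative (\<lambda>v. v)) (at x)"
    by (rule has_derivative_transform_within_open[OF has_derivative_ident open_cimg[OF assms(1)] assms(2)])
       (simp add: transition_def)
  then show ?thesis
    unfolding jac_def jacobian_def
    by (simp add: frechet_derivative_eq matrix_id_mat_1[unfolded id_def])
qed

text \<open>Chain rule for transition maps. The composite agrees with \<open>transition c e\<close>
  only on the open set \<open>?O\<close>, which is enough for the derivative. This is why
  \<open>vec_at\<close> obeys the transformation law of tangent vectors.\<close>

lemma jac_cocycle:
  assumes A: "c \<in> A" "d \<in> A" "e \<in> A" and p: "p \<in> cdom c" "p \<in> cdom d" "p \<in> cdom e"
  shows "jac c e (cmap c p) = jac d e (cmap d p) ** jac c d (cmap c p)"
proof -
  let ?x = "cmap c p" and ?O = "overlap c d \<inter> overlap c e"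
  have x: "?x \<in> overlap c d" "?x \<in> overlap c e" and y: "cmap d p \<in> overlap d e"
    using A p by (simp_all add: overlap_iff)
  have "(transition d e has_derivative (*v) (jac d e (cmap d p))) (at (transition c d ?x))"
    using transition_deriv[OF A(2,3) y] transition_cmap[OF A(1) p(1)] by simp
  from has_derivative_compose[OF transition_deriv[OF A(1,2) x(1)] this]
  have "((\<lambda>x. transition d e (transition c d x)) has_derivative
      (\<lambda>v. jac d e (cmap d p) *v (jac c d ?x *v v))) (at ?x)" .
  then have "(transition c e has_derivative (\<lambda>v. jac d e (cmap d p) *v (jac c d ?x *v v))) (at ?x)"
  proof (rule has_derivative_transform_within_open)
    show "open ?O" using open_overlap A by blast
    show "?x \<in> ?O" using x by simp
    show "transition d e (transition c d z) = transition c e z" if "z \<in> ?O" for z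
      using that A by (auto simp: overlap_def transition_def dest: inj_onD[OF inj_cmap])
  qed
  then have "(*v) (jac c e ?x) = (\<lambda>v. jac d e (cmap d p) *v (jac c d ?x *v v))"
    using transition_deriv[OF A(1,3) x(2)] has_derivative_unique by blast
  then show ?thesis by (metis matrix_eq matrix_vector_mul_assoc)
qed

lemma vec_at_chart:
  "c \<in> A \<Longrightarrow> d \<in> A \<Longrightarrow> p \<in> cdom c \<Longrightarrow> p \<in> cdom d \<Longrightarrow> vec_at A c (cmap c p) y d = jac c d (cmap c p) *v y"
  by (simp add: vec_at_def)

lemma vec_at_self [simp]: "c \<in> A \<Longrightarrow> p \<in> cdom c \<Longrightarrow> vec_at A c (cmap c p) y c = y"
  by (simp add: vec_at_chart jac_refl)

lemma vec_at_tangent: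
  assumes c: "c \<in> A" and p: "p \<in> cdom c"
  shows "vec_at A c (cmap c p) y \<in> tangent_space A p"
proof -
  have "vec_at A c (cmap c p) y e = jac d e (cmap d p) *v vec_at A c (cmap c p) y d"
    if "d \<in> A" "e \<in> A" "p \<in> cdom d" "p \<in> cdom e" for d e
    using that c p jac_cocycle[OF c that(1,2) p that(3,4)]
    by (simp add: vec_at_chart matrix_vector_mul_assoc)
  moreover have "vec_at A c (cmap c p) y d = 0" if "\<not> (d \<in> A \<and> p \<in> cdom d)" for d
    using that c p by (auto simp: vec_at_def)
  ultimately show ?thesis unfolding tangent_space_def by blast
qed

text \<open>The convention that entries of foreign charts are 0 makes this an equality of functions:
  one component determines the whole vector.\<close>

lemma tangent_eq_vec_at:
  assumes c: "c \<in> A" and p: "p \<in> cdom c" and \<xi>: "\<xi> \<in> tangent_space A p"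
  shows "\<xi> = vec_at A c (cmap c p) (\<xi> c)"
proof
  fix d
  show "\<xi> d = vec_at A c (cmap c p) (\<xi> c) d"
  proof (cases "d \<in> A \<and> p \<in> cdom d")
    case True
    then have "\<xi> d = jac c d (cmap c p) *v \<xi> c"
      using \<xi> c p unfolding tangent_space_def by blast
    then show ?thesis using True c p by (simp add: vec_at_chart)
  next
    case False
    then have "\<xi> d = 0" using \<xi> unfolding tangent_space_def by blast
    then show ?thesis using False c p by (auto simp: vec_at_def)
  qed
qed

lemma tangent_zero_iff:
  assumes "c \<in> A" "p \<in> cdom c" "\<xi> \<in> tangent_space A p"
  shows "\<xi> c = 0 \<longleftrightarrow> \<xi> = (\<lambda>_. 0)"
proof
  assume "\<xi> c = 0"
  then have "\<xi> = vec_at A c (cmap c p) 0" using tangent_eq_vec_at[OF assms] by simp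
  then show "\<xi> = (\<lambda>_. 0)" by (simp add: vec_at_def fun_eq_iff)
qed simp

lemma vec_at_scale: "vec_at A c x (a *\<^sub>R y) = scale_tvec a (vec_at A c x y)"
  by (simp add: vec_at_def scale_tvec_def fun_eq_iff matrix_vector_mult_scaleR)

lemma vec_at_lin_comb: "vec_at A c x (a *\<^sub>R y + b *\<^sub>R z) = lin_comb a (vec_at A c x y) b (vec_at A c x z)"
  by (simp add: vec_at_def lin_comb_def fun_eq_iff matrix_vector_mult_scaleR matrix_vector_right_distrib)

lemma tangent_lin_comb:
  assumes "\<xi> \<in> tangent_space A p" "\<eta> \<in> tangent_space A p"
  shows "lin_comb a \<xi> b \<eta> \<in> tangent_space A p"
  unfolding tangent_space_def
proof (intro CollectI conjI ballI allI impI)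
  fix c d assume "c \<in> A" "d \<in> A" "p \<in> cdom c" "p \<in> cdom d"
  then have "\<xi> d = jac c d (cmap c p) *v \<xi> c" "\<eta> d = jac c d (cmap c p) *v \<eta> c"
    using assms unfolding tangent_space_def by blast+
  then show "lin_comb a \<xi> b \<eta> d = jac c d (cmap c p) *v lin_comb a \<xi> b \<eta> c"
    by (simp add: lin_comb_def matrix_vector_mult_scaleR matrix_vector_right_distrib)
next
  fix c assume "\<not> (c \<in> A \<and> p \<in> cdom c)"
  then have "\<xi> c = 0" "\<eta> c = 0" using assms unfolding tangent_space_def by blast+
  then show "lin_comb a \<xi> b \<eta> c = 0" by (simp add: lin_comb_def)
qed

end


section \<open>Parallel transport\<close>

text \<open>A version of \<open>parallel_along\<close> on arbitrary intervals, made for cutting and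
  gluing. The equation is asked only at interior times, with two-sided derivatives, so no one-sided
  derivative has to be tracked at a junction; continuity covers the ends.\<close>

definition parallel_on ::
  "('a, 'n::finite) chart set \<Rightarrow> (('a, 'n) chart \<Rightarrow> (real^'n, 'n) conn_form) \<Rightarrow> (real \<Rightarrow> 'a) \<Rightarrow>
   real \<Rightarrow> real \<Rightarrow> (real \<Rightarrow> ('a, 'n) tvec) \<Rightarrow> bool" where
  "parallel_on A D \<gamma> a b X \<longleftrightarrow>
     (\<forall>t\<in>{a..b}. X t \<in> tangent_space A (\<gamma> t)) \<and>
     (\<forall>c\<in>A. continuous_on {t \<in> {a..b}. \<gamma> t \<in> cdom c} (\<lambda>t. X t c)) \<and>
     (\<exists>S. finite S \<and>
        (\<forall>t\<in>{a<..<b} - S. \<forall>c\<in>A. \<gamma> t \<in> cdom c \<longrightarrow>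
           (\<exists>v. ((\<lambda>s. cmap c (\<gamma> s)) has_vector_derivative v) (at t) \<and>
              ((\<lambda>s. X s c) has_vector_derivative - (D c (cmap c (\<gamma> t)) v *v X t c)) (at t))))"

text \<open>Inside the interval one-sided and two-sided derivatives coincide, and the two end times
  can be put into the finite exceptional set.\<close>

lemma parallel_along_iff: "parallel_along A D \<gamma> X \<longleftrightarrow> parallel_on A D \<gamma> 0 1 X"
proof -
  have w: "at t within {0..1} = at t" if "t \<in> {0<..<1}" for t :: real
    using that by (intro at_within_interior) auto
  define P where "P = (\<lambda>t N. \<forall>c\<in>A. \<gamma> t \<in> cdom c \<longrightarrow>
           (\<exists>v. ((\<lambda>s. cmap c (\<gamma> s)) has_vector_derivative v) N \<and>
              ((\<lambda>s. X s c) has_vector_derivative - (D c (cmap c (\<gamma> t)) v *v X t c)) N))"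
  have "(\<exists>S. finite S \<and> (\<forall>t\<in>{0..1} - S. P t (at t within {0..1})))
     \<longleftrightarrow> (\<exists>S. finite S \<and> (\<forall>t\<in>{0<..<1} - S. P t (at t)))" (is "?l = ?r")
  proof
    assume ?l
    then obtain S where "finite S" "\<forall>t\<in>{0..1} - S. P t (at t within {0..1})" by blast
    then show ?r using w by (intro exI[of _ S]) (metis (no_types, lifting) Diff_iff atLeastAtMost_iff
          greaterThanLessThan_iff less_imp_le)
  next
    assume ?r
    then obtain S where "finite S" "\<forall>t\<in>{0<..<1} - S. P t (at t)" by blast
    then show ?l using w by (intro exI[of _ "S \<union> {0, 1}"]) auto
  qed
  then show ?thesis unfolding parallel_along_def parallel_on_def P_def comp_def by simp
qed

lemma parallel_on_singleton:
  "\<xi> \<in> tangent_space A (\<gamma> a) \<Longrightarrow> parallel_on A D \<gamma> a a (\<lambda>_. \<xi>)"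
  by (auto simp: parallel_on_def intro: continuous_on_const)

text \<open>The junction \<open>b\<close> joins the exceptional set, so the derivatives from its two
  sides need not match. Continuity there follows because the two pieces are relatively closed and
  agree at \<open>b\<close>.\<close>

lemma parallel_on_glue:
  assumes ab: "a \<le> b" "b \<le> c" and X: "parallel_on A D \<gamma> a b X" and Y: "parallel_on A D \<gamma> b c Y"
    and eq: "X b = Y b"
  shows "parallel_on A D \<gamma> a c (\<lambda>t. if t \<le> b then X t else Y t)" (is "parallel_on _ _ _ _ _ ?Z")
proof -
  obtain S1 where S1: "finite S1" "\<And>t e. t\<in>{a<..<b} - S1 \<Longrightarrow> e\<in>A \<Longrightarrow> \<gamma> t \<in> cdom e \<Longrightarrow>
           (\<exists>v. ((\<lambda>s. cmap e (\<gamma> s)) has_vector_derivative v) (at t) \<and>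
              ((\<lambda>s. X s e) has_vector_derivative - (D e (cmap e (\<gamma> t)) v *v X t e)) (at t))"
    using X unfolding parallel_on_def by blast
  obtain S2 where S2: "finite S2" "\<And>t e. t\<in>{b<..<c} - S2 \<Longrightarrow> e\<in>A \<Longrightarrow> \<gamma> t \<in> cdom e \<Longrightarrow>
           (\<exists>v. ((\<lambda>s. cmap e (\<gamma> s)) has_vector_derivative v) (at t) \<and>
              ((\<lambda>s. Y s e) has_vector_derivative - (D e (cmap e (\<gamma> t)) v *v Y t e)) (at t))"
    using Y unfolding parallel_on_def by blast
  have tan: "?Z t \<in> tangent_space A (\<gamma> t)" if "t \<in> {a..c}" for t
    using X Y that unfolding parallel_on_def by auto
  have cont: "continuous_on {t \<in> {a..c}. \<gamma> t \<in> cdom e} (\<lambda>t. ?Z t e)" if "e \<in> A" for e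
  proof -
    let ?J = "{t \<in> {a..b}. \<gamma> t \<in> cdom e}" and ?K = "{t \<in> {b..c}. \<gamma> t \<in> cdom e}"
    have JK: "{t \<in> {a..c}. \<gamma> t \<in> cdom e} = ?J \<union> ?K" using ab by auto
    have "?J = (?J \<union> ?K) \<inter> {..b}" "?K = (?J \<union> ?K) \<inter> {b..}" using ab by auto
    then have cl: "closedin (top_of_set (?J \<union> ?K)) ?J" "closedin (top_of_set (?J \<union> ?K)) ?K"
      using closed_atMost closed_atLeast closedin_closed by blast+
    have "continuous_on (?J \<union> ?K) (\<lambda>t. if t \<le> b then X t e else Y t e)"
    proof (rule continuous_on_cases_local[OF cl])
      show "continuous_on ?J (\<lambda>t. X t e)" "continuous_on ?K (\<lambda>t. Y t e)"
        using X Y \<open>e \<in> A\<close> unfolding parallel_on_def by blast+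
      fix t assume "t \<in> ?J \<and> \<not> t \<le> b \<or> t \<in> ?K \<and> t \<le> b"
      then have "t = b" by auto
      then show "X t e = Y t e" using eq by simp
    qed
    then show ?thesis unfolding JK by (simp add: if_distrib[of "\<lambda>f. f e"])
  qed
  have "\<exists>v. ((\<lambda>s. cmap e (\<gamma> s)) has_vector_derivative v) (at t) \<and>
        ((\<lambda>s. ?Z s e) has_vector_derivative - (D e (cmap e (\<gamma> t)) v *v ?Z t e)) (at t)"
    if t: "t \<in> {a<..<c} - (S1 \<union> S2 \<union> {b})" and e: "e \<in> A" "\<gamma> t \<in> cdom e" for t e
  proof (cases "t < b")
    case True
    then obtain v where v: "((\<lambda>s. cmap e (\<gamma> s)) has_vector_derivative v) (at t)"
      "((\<lambda>s. X s e) has_vector_derivative - (D e (cmap e (\<gamma> t)) v *v X t e)) (at t)"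
      using S1(2)[of t e] t e by auto
    have "((\<lambda>s. ?Z s e) has_vector_derivative - (D e (cmap e (\<gamma> t)) v *v X t e)) (at t)"
      by (rule has_vector_derivative_transform_within_open[OF v(2), of "{..<b}"]) (use True in auto)
    then show ?thesis using v(1) True by auto
  next
    case False
    with t have b: "b < t" by auto
    then obtain v where v: "((\<lambda>s. cmap e (\<gamma> s)) has_vector_derivative v) (at t)"
      "((\<lambda>s. Y s e) has_vector_derivative - (D e (cmap e (\<gamma> t)) v *v Y t e)) (at t)"
      using S2(2)[of t e] t e by auto
    have "((\<lambda>s. ?Z s e) has_vector_derivative - (D e (cmap e (\<gamma> t)) v *v Y t e)) (at t)"
      by (rule has_vector_derivative_transform_within_open[OF v(2), of "{b<..}"]) (use b in auto)
    then show ?thesis using v(1) b by auto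
  qed
  note ode = this
  show ?thesis unfolding parallel_on_def
  proof (intro conjI ballI impI exI[of _ "S1 \<union> S2 \<union> {b}"])
    show "finite (S1 \<union> S2 \<union> {b})" using S1 S2 by simp
  qed (fact tan cont ode)+
qed

lemma parallel_on_lin_comb:
  assumes "smooth_manifold T A" and X: "parallel_on A D \<gamma> a b X" and Y: "parallel_on A D \<gamma> a b Y"
  shows "parallel_on A D \<gamma> a b (\<lambda>t. lin_comb r (X t) q (Y t))"
proof -
  interpret smooth_atlas T A by standard fact
  obtain S1 where S1: "finite S1" "\<And>t e. t\<in>{a<..<b} - S1 \<Longrightarrow> e\<in>A \<Longrightarrow> \<gamma> t \<in> cdom e \<Longrightarrow>
           (\<exists>v. ((\<lambda>s. cmap e (\<gamma> s)) has_vector_derivative v) (at t) \<and>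
              ((\<lambda>s. X s e) has_vector_derivative - (D e (cmap e (\<gamma> t)) v *v X t e)) (at t))"
    using X unfolding parallel_on_def by blast
  obtain S2 where S2: "finite S2" "\<And>t e. t\<in>{a<..<b} - S2 \<Longrightarrow> e\<in>A \<Longrightarrow> \<gamma> t \<in> cdom e \<Longrightarrow>
           (\<exists>v. ((\<lambda>s. cmap e (\<gamma> s)) has_vector_derivative v) (at t) \<and>
              ((\<lambda>s. Y s e) has_vector_derivative - (D e (cmap e (\<gamma> t)) v *v Y t e)) (at t))"
    using Y unfolding parallel_on_def by blast
  have tan: "lin_comb r (X t) q (Y t) \<in> tangent_space A (\<gamma> t)" if "t \<in> {a..b}" for t
    using X Y that unfolding parallel_on_def by (intro tangent_lin_comb) auto
  have cont: "continuous_on {t \<in> {a..b}. \<gamma> t \<in> cdom e} (\<lambda>t. lin_comb r (X t) q (Y t) e)" if "e \<in> A" for e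
    using X Y that unfolding parallel_on_def lin_comb_def by (intro continuous_intros) auto
  have "\<exists>v. ((\<lambda>s. cmap e (\<gamma> s)) has_vector_derivative v) (at t) \<and>
        ((\<lambda>s. lin_comb r (X s) q (Y s) e) has_vector_derivative
          - (D e (cmap e (\<gamma> t)) v *v lin_comb r (X t) q (Y t) e)) (at t)"
    if t: "t \<in> {a<..<b} - (S1 \<union> S2)" and e: "e \<in> A" "\<gamma> t \<in> cdom e" for t e
  proof -
    obtain v where v: "((\<lambda>s. cmap e (\<gamma> s)) has_vector_derivative v) (at t)"
      "((\<lambda>s. X s e) has_vector_derivative - (D e (cmap e (\<gamma> t)) v *v X t e)) (at t)"
      using S1(2)[of t e] t e by auto
    obtain w where w: "((\<lambda>s. cmap e (\<gamma> s)) has_vector_derivative w) (at t)"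
      "((\<lambda>s. Y s e) has_vector_derivative - (D e (cmap e (\<gamma> t)) w *v Y t e)) (at t)"
      using S2(2)[of t e] t e by auto
    \<comment> \<open>The two fields come with separate velocity witnesses; uniqueness of
      derivatives identifies them, so one matrix acts on both fields.\<close>
    have "v = w" using v(1) w(1) by (rule vector_derivative_unique_at)
    have "((\<lambda>s. r *\<^sub>R X s e + q *\<^sub>R Y s e) has_vector_derivative
        r *\<^sub>R - (D e (cmap e (\<gamma> t)) v *v X t e) + q *\<^sub>R - (D e (cmap e (\<gamma> t)) v *v Y t e)) (at t)"
      using v(2) w(2) \<open>v = w\<close>
      by (intro has_vector_derivative_add bounded_linear.has_vector_derivative[OF bounded_linear_scaleR_right]) auto
    then show ?thesis using v(1)
      by (auto simp: lin_comb_def matrix_vector_mult_scaleR matrix_vector_right_distrib)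
  qed
  moreover have "finite (S1 \<union> S2)" using S1 S2 by simp
  ultimately show ?thesis unfolding parallel_on_def using tan cont by blast
qed

context smooth_atlas
begin

section \<open>Curves in charts, conserved quantities and local solutions\<close>

lemma curve_preimage_open:
  assumes "continuous_map (top_of_set I) T \<gamma>" "c \<in> A"
  obtains U :: "real set" where "open U" "{t \<in> I. \<gamma> t \<in> cdom c} = I \<inter> U"
  using openin_continuous_map_preimage[OF assms(1) open_cdom[OF assms(2)]]
  by (auto simp: openin_open)

lemma cmap_curve_continuous:
  fixes I :: "real set"
  assumes \<gamma>: "continuous_map (top_of_set I) T \<gamma>" and c: "c \<in> A"
  shows "continuous_on {t \<in> I. \<gamma> t \<in> cdom c} (\<lambda>t. cmap c (\<gamma> t))"
proof -
  let ?J = "{t \<in> I. \<gamma> t \<in> cdom c}"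
  have "continuous_map (top_of_set ?J) (subtopology T (cdom c)) \<gamma>"
    using continuous_map_from_subtopology[OF \<gamma>, of ?J]
    by (auto simp: continuous_map_in_subtopology subtopology_subtopology Int_absorb1)
  moreover have "continuous_map (subtopology T (cdom c)) (top_of_set (cimg c)) (cmap c)"
    by (rule homeomorphic_imp_continuous_map[OF chart_homeo[OF c]])
  ultimately have "continuous_map (top_of_set ?J) (top_of_set (cimg c)) (cmap c \<circ> \<gamma>)"
    by (rule continuous_map_compose)
  then show ?thesis by (simp add: continuous_map_in_subtopology comp_def)
qed

lemma curve_in_topspace: "continuous_map (top_of_set I) T \<gamma> \<Longrightarrow> t \<in> I \<Longrightarrow> \<gamma> t \<in> topspace T"
  unfolding continuous_map_def by auto

text \<open>The conservation principle behind both \<open>h(X, X)\<close> and \<open>F\<close>. By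
  the chain rule the local expression \<open>\<phi> c\<close> has zero derivative along a parallel
  field wherever the equation holds, and continuity bridges the finitely many other times.\<close>

lemma parallel_constant:
  fixes \<Phi> :: "real \<Rightarrow> real"
  assumes \<gamma>: "continuous_map (top_of_set {0..1}) T \<gamma>" and X: "parallel_on A D \<gamma> 0 1 X"
    and \<Phi>: "\<And>c t. c \<in> A \<Longrightarrow> t \<in> {0..1} \<Longrightarrow> \<gamma> t \<in> cdom c \<Longrightarrow> \<Phi> t = \<phi> c (cmap c (\<gamma> t), X t c)"
    and deriv: "\<And>c t. c \<in> A \<Longrightarrow> t \<in> {0..1} \<Longrightarrow> \<gamma> t \<in> cdom c \<Longrightarrow>
      \<exists>\<phi>'. (\<phi> c has_derivative \<phi>') (at (cmap c (\<gamma> t), X t c)) \<and>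
         (\<forall>v. \<phi>' (v, - (D c (cmap c (\<gamma> t)) v *v X t c)) = 0)"
    and t: "t \<in> {0..1}"
  shows "\<Phi> t = \<Phi> 0"
proof -
  obtain S where S: "finite S" "\<And>t c. t\<in>{0<..<1} - S \<Longrightarrow> c\<in>A \<Longrightarrow> \<gamma> t \<in> cdom c \<Longrightarrow>
           (\<exists>v. ((\<lambda>s. cmap c (\<gamma> s)) has_vector_derivative v) (at t) \<and>
              ((\<lambda>s. X s c) has_vector_derivative - (D c (cmap c (\<gamma> t)) v *v X t c)) (at t))"
    using X unfolding parallel_on_def by blast
  show ?thesis
  \<comment> \<open>The exceptional set absorbs the end times, where \<open>parallel_on\<close>
    provides no derivative.\<close>
  proof (rule has_derivative_zero_unique_strong_interval[of "S \<union> {0, 1}" 0 1 \<Phi>])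
    show "finite (S \<union> {0, 1})" using S by simp
    show "continuous_on {0..1} \<Phi>" unfolding continuous_on_eq_continuous_within
    proof
      fix t :: real assume t: "t \<in> {0..1}"
      obtain c where c: "c \<in> A" "\<gamma> t \<in> cdom c"
        using curve_in_topspace[OF \<gamma> t] cdom_cover by blast
      obtain U where U: "open U" "{t \<in> {0..1}. \<gamma> t \<in> cdom c} = {0..1} \<inter> U"
        using curve_preimage_open[OF \<gamma> c(1)] .
      have "continuous (at t within {0..1} \<inter> U) (\<lambda>s. (cmap c (\<gamma> s), X s c))"
      proof -
        have "continuous_on ({0..1} \<inter> U) (\<lambda>s. (cmap c (\<gamma> s), X s c))"
          unfolding U(2)[symmetric]
          using cmap_curve_continuous[OF \<gamma> c(1)] X c(1) unfolding parallel_on_def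
          by (intro continuous_on_Pair) auto
        then show ?thesis
          using t c U(2) unfolding continuous_on_eq_continuous_within by blast
      qed
      moreover have "isCont (\<phi> c) (cmap c (\<gamma> t), X t c)"
        using deriv[OF c(1) t c(2)] has_derivative_continuous by blast
      ultimately have "continuous (at t within {0..1} \<inter> U) (\<lambda>s. \<phi> c (cmap c (\<gamma> s), X s c))"
        by (rule continuous_within_compose3[rotated])
      then have "continuous (at t within {0..1} \<inter> U) \<Phi>"
      proof (rule continuous_transform_within[where \<delta> = 1])
        fix s assume "s \<in> {0..1} \<inter> U"
        then have "s \<in> {0..1}" "\<gamma> s \<in> cdom c" using U(2) by blast+
        then show "\<phi> c (cmap c (\<gamma> s), X s c) = \<Phi> s" using \<Phi>[OF c(1)] by simp
      qed (use t c U(2) in auto)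
      moreover have "at t within {0..1} \<inter> U = at t within {0..1}"
        by (rule at_within_nhd[OF _ U(1)]) (use t c U(2) in auto)
      ultimately show "continuous (at t within {0..1}) \<Phi>" by simp
    qed
    fix t :: real assume t: "t \<in> {0..1} - (S \<union> {0, 1})"
    then have t': "t \<in> {0..1}" "t \<in> {0<..<1} - S" by auto
    obtain c where c: "c \<in> A" "\<gamma> t \<in> cdom c"
      using curve_in_topspace[OF \<gamma> t'(1)] cdom_cover by blast
    obtain U where U: "open U" "{t \<in> {0..1}. \<gamma> t \<in> cdom c} = {0..1} \<inter> U"
      using curve_preimage_open[OF \<gamma> c(1)] .
    obtain v where v: "((\<lambda>s. cmap c (\<gamma> s)) has_vector_derivative v) (at t)"
      "((\<lambda>s. X s c) has_vector_derivative - (D c (cmap c (\<gamma> t)) v *v X t c)) (at t)"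
      using S(2)[OF t'(2) c] by blast
    obtain \<phi>' where \<phi>': "(\<phi> c has_derivative \<phi>') (at (cmap c (\<gamma> t), X t c))"
      "\<And>v. \<phi>' (v, - (D c (cmap c (\<gamma> t)) v *v X t c)) = 0"
      using deriv[OF c(1) t'(1) c(2)] by blast
    have "((\<lambda>s. (cmap c (\<gamma> s), X s c)) has_derivative
      (\<lambda>r. (r *\<^sub>R v, r *\<^sub>R - (D c (cmap c (\<gamma> t)) v *v X t c)))) (at t)"
      using v unfolding has_vector_derivative_def by (rule has_derivative_Pair)
    from has_derivative_compose[OF this \<phi>'(1)]
    have "((\<lambda>s. \<phi> c (cmap c (\<gamma> s), X s c)) has_derivative
      (\<lambda>r. \<phi>' (r *\<^sub>R (v, - (D c (cmap c (\<gamma> t)) v *v X t c))))) (at t)" by simp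
    then have "((\<lambda>s. \<phi> c (cmap c (\<gamma> s), X s c)) has_derivative (\<lambda>r. 0)) (at t)"
      by (simp only: linear_scale[OF has_derivative_linear[OF \<phi>'(1)]] \<phi>'(2) scaleR_zero_right)
    then have "(\<Phi> has_derivative (\<lambda>r. 0)) (at t)"
    proof (rule has_derivative_transform_within_open)
      show "open (U \<inter> {0<..<1})" using U by auto
      show "t \<in> U \<inter> {0<..<1}" using U(2) c t' by blast
      fix s assume "s \<in> U \<inter> {0<..<1}"
      then have "s \<in> {0..1} \<inter> U" by auto
      then have "s \<in> {0..1}" "\<gamma> s \<in> cdom c" using U(2) by blast+
      then show "\<phi> c (cmap c (\<gamma> s), X s c) = \<Phi> s" using \<Phi>[OF c(1)] by simp
    qed
    then show "(\<Phi> has_derivative (\<lambda>h. 0)) (at t within {0..1})"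
      by (rule has_derivative_at_withinI)
  qed (use t in simp_all)
qed

text \<open>The equation is solved in the single chart \<open>c\<close>, and the gauge relation
  carries it to all other charts. The length \<open>d\<close> serves every base time
  \<open>t0\<close>, so the value may be prescribed at either end of a short interval.\<close>

lemma local_transport:
  assumes D: "linear_connection_TM A D" and c: "c \<in> A"
    and \<gamma>: "C1_curve_on T A {p..q} \<gamma>" and sub: "\<gamma> ` {p..q} \<subseteq> cdom c"
  shows "\<exists>d>0. \<forall>a b t0 \<xi>. p \<le> a \<longrightarrow> b \<le> q \<longrightarrow> b - a < d \<longrightarrow> t0 \<in> {a..b} \<longrightarrow>
    \<xi> \<in> tangent_space A (\<gamma> t0) \<longrightarrow> (\<exists>X. parallel_on A D \<gamma> a b X \<and> X t0 = \<xi>)"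
proof -
  define y where "y = (\<lambda>t. cmap c (\<gamma> t))"
  have inc: "\<gamma> t \<in> cdom c" if "t \<in> {p..q}" for t using sub that by auto
  have yc: "y t \<in> cimg c" if "t \<in> {p..q}" for t using inc[OF that] by (simp add: y_def)
  have "{t \<in> {p..q}. \<gamma> t \<in> cdom c} = {p..q}" using inc by auto
  with \<gamma> c obtain v where v: "continuous_on {p..q} v"
    "\<And>t. t \<in> {p..q} \<Longrightarrow> (y has_vector_derivative v t) (at t within {p..q})"
    unfolding C1_curve_on_def y_def comp_def using inc by (metis (no_types, lifting))
  have ycont: "continuous_on {p..q} y"
    using v(2) has_vector_derivative_continuous continuous_on_eq_continuous_within by blast
  have Dc: "smooth_conn_form (cimg c) (D c)" using D c by (simp add: linear_connection_TM_def)
  define B where "B = (\<lambda>t. - D c (y t) (v t))"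
  have "continuous_on {p..q} B"
  proof -
    \<comment> \<open>A smooth connection form is given as continuous in the point for each fixed
      direction; continuity along the moving velocity comes from expanding it in the standard
      basis.\<close>
    have "continuous_on (cimg c) (\<lambda>z. D c z (axis i 1))" for i
      using Dc smooth_on_imp_continuous_on unfolding smooth_conn_form_def by blast
    then have "continuous_on {p..q} (\<lambda>t. D c (y t) (axis i 1))" for i
      by (rule continuous_on_compose2[OF _ ycont]) (use yc in auto)
    then have "continuous_on {p..q} (\<lambda>t. - (\<Sum>i\<in>UNIV. v t $ i *\<^sub>R D c (y t) (axis i 1)))"
      by (intro continuous_intros v(1))
    then show ?thesis
    proof (rule continuous_on_eq)
      show "- (\<Sum>i\<in>UNIV. v t $ i *\<^sub>R D c (y t) (axis i 1)) = B t" if "t \<in> {p..q}" for t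
        using linear_sum_axis[of "D c (y t)" "v t"] Dc yc[OF that]
        by (simp add: B_def smooth_conn_form_def)
    qed
  qed
  from linear_ode_exists[OF this] obtain d where d: "d > 0"
    "\<And>a b t0 x0. p \<le> a \<Longrightarrow> b \<le> q \<Longrightarrow> b - a < d \<Longrightarrow> t0 \<in> {a..b} \<Longrightarrow>
    (\<exists>x. x t0 = x0 \<and> (\<forall>t\<in>{a..b}. (x has_vector_derivative B t *v x t) (at t within {a..b})))"
    by blast
  have "\<exists>X. parallel_on A D \<gamma> a b X \<and> X t0 = \<xi>"
    if ab: "p \<le> a" "b \<le> q" "b - a < d" and t0: "t0 \<in> {a..b}" and \<xi>: "\<xi> \<in> tangent_space A (\<gamma> t0)"
    for a b t0 \<xi>
  proof -
    obtain x where x: "x t0 = \<xi> c"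
      "\<And>t. t \<in> {a..b} \<Longrightarrow> (x has_vector_derivative B t *v x t) (at t within {a..b})"
      using d(2)[OF ab t0] by blast
    have xcont: "continuous_on {a..b} x"
      using x(2) has_vector_derivative_continuous continuous_on_eq_continuous_within by blast
    have pq: "t \<in> {p..q}" if "t \<in> {a..b}" for t using that ab by auto
    define X where "X = (\<lambda>t. vec_at A c (y t) (x t))"
    have Xe: "X t e = jac c e (y t) *v x t" if "t \<in> {p..q}" "e \<in> A" "\<gamma> t \<in> cdom e" for t e
      unfolding X_def y_def using that c inc by (simp add: vec_at_chart)
    have ye: "y t \<in> overlap c e" if "t \<in> {p..q}" "e \<in> A" "\<gamma> t \<in> cdom e" for t e
      unfolding y_def using that c inc by (simp add: overlap_iff)
    have "X t0 = \<xi>"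
      unfolding X_def y_def x(1) using tangent_eq_vec_at[OF c inc[OF pq[OF t0]] \<xi>] by simp
    moreover have "parallel_on A D \<gamma> a b X" unfolding parallel_on_def
    proof (intro conjI ballI exI[of _ "{}"] impI)
      show "X t \<in> tangent_space A (\<gamma> t)" if "t \<in> {a..b}" for t
        unfolding X_def y_def by (rule vec_at_tangent[OF c inc[OF pq[OF that]]])
    next
      fix e assume e: "e \<in> A"
      let ?J = "{t \<in> {a..b}. \<gamma> t \<in> cdom e}"
      have "continuous_on (overlap c e) (jac c e)"
        using jac_deriv[OF c e] has_derivative_continuous continuous_at_imp_continuous_on by blast
      then have "continuous_on ?J (\<lambda>t. jac c e (y t))"
        by (rule continuous_on_compose2[OF _ continuous_on_subset[OF ycont]]) (use ye[OF _ e] pq in auto)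
      then have "continuous_on ?J (\<lambda>t. jac c e (y t) *v x t)"
        by (rule bounded_bilinear.continuous_on[OF bounded_bilinear_matrix_vector])
           (rule continuous_on_subset[OF xcont], auto)
      then show "continuous_on ?J (\<lambda>t. X t e)"
        by (rule continuous_on_eq) (use Xe[OF _ e] pq in auto)
    next
      fix t e assume t: "t \<in> {a<..<b} - {}" and e: "e \<in> A" "\<gamma> t \<in> cdom e"
      have tab: "t \<in> {a..b}" and tpq: "t \<in> {p..q}" using t ab by auto
      have yo: "y t \<in> overlap c e" using ye[OF tpq e] .
      have "at t within {p..q} = at t" "at t within {a..b} = at t"
        using t ab by (auto intro!: at_within_interior)
      with v(2)[OF tpq] x(2)[OF tab] have yd: "(y has_vector_derivative v t) (at t)"
        and xd: "(x has_vector_derivative B t *v x t) (at t)" by simp_all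
      \<comment> \<open>Formulas through chart \<open>c\<close> describe the curve and the field in
        chart \<open>e\<close> only while the curve lies in both domains. The overlap is open, so
        this persists for times near \<open>t\<close>.\<close>
      obtain N where N: "open N" "t \<in> N" "\<And>s. s \<in> N \<Longrightarrow> s \<in> {p..q} \<and> \<gamma> s \<in> cdom e"
      proof
        let ?N = "y -` overlap c e \<inter> {a<..<b}"
        have "continuous_on {a<..<b} y"
          by (rule continuous_on_subset[OF ycont]) (use ab in auto)
        then show "open ?N"
          using continuous_on_open_vimage[of "{a<..<b}" y] open_overlap[OF c e(1)] by simp
        show "t \<in> ?N" using yo t by simp
        fix s assume s: "s \<in> ?N"
        then have "s \<in> {p..q}" using ab by auto
        then show "s \<in> {p..q} \<and> \<gamma> s \<in> cdom e"
          using s overlap_iff[OF c inc] by (auto simp: y_def)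
      qed
      have "((\<lambda>s. transition c e (y s)) has_vector_derivative jac c e (y t) *v v t) (at t)"
        using has_derivative_compose[OF yd[unfolded has_vector_derivative_def] transition_deriv[OF c e(1) yo]]
        by (simp add: has_vector_derivative_def matrix_vector_mult_scaleR)
      then have ed: "((\<lambda>s. cmap e (\<gamma> s)) has_vector_derivative jac c e (y t) *v v t) (at t)"
        by (rule has_vector_derivative_transform_within_open[OF _ N(1,2)])
           (use N(3) c inc in \<open>simp add: y_def transition_cmap\<close>)
      let ?J' = "frechet_derivative (jac c e) (at (y t))"
      have "((\<lambda>s. jac c e (y s)) has_vector_derivative ?J' (v t)) (at t)"
        using has_derivative_compose[OF yd[unfolded has_vector_derivative_def] jac_deriv[OF c e(1) yo]]
        by (simp add: has_vector_derivative_def linear_scale[OF has_derivative_linear[OF jac_deriv[OF c e(1) yo]]])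
      from bounded_bilinear.has_vector_derivative[OF bounded_bilinear_matrix_vector this xd]
      have "((\<lambda>s. jac c e (y s) *v x s) has_vector_derivative
          jac c e (y t) *v (B t *v x t) + ?J' (v t) *v x t) (at t)" .
      \<comment> \<open>In the gauge law \<open>J \<omega> = dJ + \<omega>' J\<close> the term
        \<open>dJ\<close> is exactly what the product rule contributes by differentiating the
        Jacobian, so only the form of chart \<open>e\<close> survives.\<close>
      moreover have "jac c e (y t) *v (B t *v x t) + ?J' (v t) *v x t
          = - (D e (cmap e (\<gamma> t)) (jac c e (y t) *v v t) *v X t e)"
      proof -
        have "gauge_related (overlap c e) (transition c e) (jac c e) (D c) (D e)"
          using D c e by (simp add: linear_connection_TM_def)
        then have "jac c e (y t) ** D c (y t) (v t) = ?J' (v t)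
            + D e (transition c e (y t)) (frechet_derivative (transition c e) (at (y t)) (v t)) ** jac c e (y t)"
          using yo unfolding gauge_related_def by blast
        also have "frechet_derivative (transition c e) (at (y t)) (v t) = jac c e (y t) *v v t"
          using frechet_derivative_eq[OF transition_deriv[OF c e(1) yo]] by simp
        also have "transition c e (y t) = cmap e (\<gamma> t)"
          unfolding y_def using transition_cmap[OF c inc[OF tpq]] .
        finally have "(jac c e (y t) ** D c (y t) (v t)) *v x t = (?J' (v t)
            + D e (cmap e (\<gamma> t)) (jac c e (y t) *v v t) ** jac c e (y t)) *v x t" by simp
        then have "jac c e (y t) *v (D c (y t) (v t) *v x t) = ?J' (v t) *v x t
            + D e (cmap e (\<gamma> t)) (jac c e (y t) *v v t) *v X t e"
          by (simp only: Xe[OF tpq e] matrix_vector_mult_add_rdistrib matrix_vector_mul_assoc)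
        moreover have "jac c e (y t) *v (B t *v x t) = - (jac c e (y t) *v (D c (y t) (v t) *v x t))"
          unfolding B_def using matrix_vector_mult_diff_rdistrib[of 0 "D c (y t) (v t)" "x t"]
            matrix_vector_mult_diff_distrib[of "jac c e (y t)" 0 "D c (y t) (v t) *v x t"]
          by simp
        ultimately show ?thesis by simp
      qed
      ultimately have "((\<lambda>s. jac c e (y s) *v x s) has_vector_derivative
          - (D e (cmap e (\<gamma> t)) (jac c e (y t) *v v t) *v X t e)) (at t)" by simp
      then have "((\<lambda>s. X s e) has_vector_derivative
          - (D e (cmap e (\<gamma> t)) (jac c e (y t) *v v t) *v X t e)) (at t)"
        by (rule has_vector_derivative_transform_within_open[OF _ N(1,2)]) (use N(3) Xe[OF _ e(1)] in auto)
      then show "\<exists>v. ((\<lambda>s. cmap e (\<gamma> s)) has_vector_derivative v) (at t) \<and>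
              ((\<lambda>s. X s e) has_vector_derivative - (D e (cmap e (\<gamma> t)) v *v X t e)) (at t)"
        using ed by blast
    qed simp
    ultimately show ?thesis by blast
  qed
  then show ?thesis using d(1) by blast
qed

end


section \<open>Berwald spaces\<close>

context smooth_atlas
begin

section \<open>Riemannian metrics in charts, uniqueness and existence of parallel fields\<close>

lemma cinv_in_topspace: "c \<in> A \<Longrightarrow> x \<in> cimg c \<Longrightarrow> cinv c x \<in> topspace T"
  using cinv_in_cdom cdom_cover by blast

lemma metric_loc_eq:
  assumes h: "riemannian_metric T A h" and c: "c \<in> A" and p: "p \<in> cdom c"
    and \<xi>: "\<xi> \<in> tangent_space A p" and \<eta>: "\<eta> \<in> tangent_space A p"
  shows "h p \<xi> \<eta> = \<xi> c \<bullet> (metric_loc A h c (cmap c p) *v \<eta> c)"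
proof -
  define V where "V = vec_at A c (cmap c p)"
  have pT: "p \<in> topspace T" using c p cdom_cover by blast
  have V: "V y \<in> tangent_space A p" for y unfolding V_def by (rule vec_at_tangent[OF c p])
  have bil: "h p (lin_comb a \<xi> b \<eta>) \<theta> = a * h p \<xi> \<theta> + b * h p \<eta> \<theta>"
    if "\<xi> \<in> tangent_space A p" "\<eta> \<in> tangent_space A p" "\<theta> \<in> tangent_space A p" for a b \<xi> \<eta> \<theta>
    using h pT that unfolding riemannian_metric_def by blast
  have sym: "h p \<xi> \<eta> = h p \<eta> \<xi>" if "\<xi> \<in> tangent_space A p" "\<eta> \<in> tangent_space A p" for \<xi> \<eta>
    using h pT that unfolding riemannian_metric_def by blast
  have lin: "linear (\<lambda>y. h p (V y) \<theta>)" if "\<theta> \<in> tangent_space A p" for \<theta>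
  proof (rule linearI)
    show "h p (V (y + z)) \<theta> = h p (V y) \<theta> + h p (V z) \<theta>" for y z
      using vec_at_lin_comb[of c "cmap c p" 1 y 1 z] bil[OF V V that, of 1 y 1 z] by (simp add: V_def)
    show "h p (V (r *\<^sub>R y)) \<theta> = r *\<^sub>R h p (V y) \<theta>" for r y
      using vec_at_lin_comb[of c "cmap c p" r y 0 y] bil[OF V V that, of r y 0 y] by (simp add: V_def)
  qed
  have "h p (V y) (V z) = y \<bullet> (metric_loc A h c (cmap c p) *v z)" for y z
  proof -
    have "h p (V y) (V z) = (\<Sum>i\<in>UNIV. y $ i * h p (V (axis i 1)) (V z))"
      using linear_sum_axis[OF lin[OF V], of y] by simp
    \<comment> \<open>Linearity is part of \<open>riemannian_metric\<close> in the first argument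
      only, so the second one is expanded by swapping, expanding and swapping back.\<close>
    also have "\<dots> = (\<Sum>i\<in>UNIV. y $ i * (\<Sum>j\<in>UNIV. z $ j * h p (V (axis j 1)) (V (axis i 1))))"
      using linear_sum_axis[OF lin[OF V], of z] by (subst sym[OF V V]) simp
    also have "\<dots> = (\<Sum>i\<in>UNIV. y $ i * (\<Sum>j\<in>UNIV. z $ j * h p (V (axis i 1)) (V (axis j 1))))"
      by (subst (2) sym[OF V V]) simp
    also have "\<dots> = y \<bullet> (metric_loc A h c (cmap c p) *v z)"
      by (simp add: inner_vec_def matrix_vector_mult_def metric_loc_def c p V_def mult.commute)
    finally show ?thesis .
  qed
  from this[of "\<xi> c" "\<eta> c"] show ?thesis
    by (simp only: V_def tangent_eq_vec_at[OF c p \<xi>, symmetric] tangent_eq_vec_at[OF c p \<eta>, symmetric])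
qed

lemma metric_loc_sym:
  assumes h: "riemannian_metric T A h" and c: "c \<in> A" and x: "x \<in> cimg c"
  shows "metric_loc A h c x $ i $ j = metric_loc A h c x $ j $ i"
proof -
  have p: "cinv c x \<in> cdom c" "cinv c x \<in> topspace T" using x c cinv_in_topspace by auto
  have V: "vec_at A c x y \<in> tangent_space A (cinv c x)" for y
    using vec_at_tangent[OF c p(1)] x by simp
  show ?thesis using h p(2) V unfolding riemannian_metric_def metric_loc_def by simp
qed

lemma metric_loc_pos:
  assumes h: "riemannian_metric T A h" and c: "c \<in> A" and x: "x \<in> cimg c" and y: "y \<noteq> 0"
  shows "y \<bullet> (metric_loc A h c x *v y) > 0"
proof -
  have p: "cinv c x \<in> cdom c" "cinv c x \<in> topspace T" using x c cinv_in_topspace by auto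
  have V: "vec_at A c x y \<in> tangent_space A (cinv c x)"
    using vec_at_tangent[OF c p(1)] x by simp
  have Vc: "vec_at A c x y c = y" using vec_at_self[OF c p(1)] x by simp
  then have "vec_at A c x y \<noteq> (\<lambda>_. 0)" using y by auto
  then have "h (cinv c x) (vec_at A c x y) (vec_at A c x y) > 0"
    using h p(2) V unfolding riemannian_metric_def by blast
  then show ?thesis using metric_loc_eq[OF h c p(1) V V] x Vc by simp
qed

text \<open>For the quadratic form \<open>h_ij y^i y^j\<close>, the change of \<open>h_ij\<close>
  along the curve cancels the two terms from the change of \<open>y\<close>; this is
  \<open>cov_deriv_metric_quadratic\<close>.\<close>

lemma levi_civita_preserves_metric:
  assumes h: "riemannian_metric T A h" and D: "levi_civita A h D"
    and \<gamma>: "continuous_map (top_of_set {0..1}) T \<gamma>" and X: "parallel_on A D \<gamma> 0 1 X"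
    and t: "t \<in> {0..1}"
  shows "h (\<gamma> t) (X t) (X t) = h (\<gamma> 0) (X 0) (X 0)"
proof (rule parallel_constant[OF \<gamma> X _ _ t, where \<phi> = "\<lambda>c (x, y). y \<bullet> (metric_loc A h c x *v y)"])
  fix c t assume c: "c \<in> A" and t: "t \<in> {0..1}" and p: "\<gamma> t \<in> cdom c"
  have Xt: "X t \<in> tangent_space A (\<gamma> t)" using X t unfolding parallel_on_def by blast
  show "h (\<gamma> t) (X t) (X t) = (case (cmap c (\<gamma> t), X t c) of (x, y) \<Rightarrow> y \<bullet> (metric_loc A h c x *v y))"
    using metric_loc_eq[OF h c p Xt Xt] by simp
  let ?x = "cmap c (\<gamma> t)" and ?y = "X t c"
  define H where "H = metric_loc A h c"
  define H' where "H' = frechet_derivative H (at ?x)"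
  have x: "?x \<in> cimg c" using p by simp
  have H': "(H has_derivative H') (at ?x)"
    using smooth_on_has_derivative[OF _ x] h c unfolding riemannian_metric_def H_def H'_def by blast
  have "((\<lambda>z. H (fst z)) has_derivative (\<lambda>\<zeta>. H' (fst \<zeta>))) (at (?x, ?y))"
    by (rule has_derivative_compose[where g = H and f = fst])
       (auto intro!: derivative_eq_intros H')
  from bounded_bilinear.FDERIV[OF bounded_bilinear_matrix_vector this has_derivative_snd[OF has_derivative_ident]]
  have "((\<lambda>z. H (fst z) *v snd z) has_derivative
      (\<lambda>\<zeta>. H ?x *v snd \<zeta> + H' (fst \<zeta>) *v ?y)) (at (?x, ?y))" by simp
  then have "((\<lambda>z. snd z \<bullet> (H (fst z) *v snd z)) has_derivative
      (\<lambda>\<zeta>. ?y \<bullet> (H ?x *v snd \<zeta> + H' (fst \<zeta>) *v ?y) + snd \<zeta> \<bullet> (H ?x *v ?y))) (at (?x, ?y))"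
    by (auto intro!: derivative_eq_intros)
  moreover have "?y \<bullet> (H ?x *v w + H' v *v ?y) + w \<bullet> (H ?x *v ?y) = 0"
    if w: "w = - (D c ?x v *v ?y)" for v w
  proof -
    have "cov_deriv_metric (D c) H ?x v i j = 0" for i j
      using D c x unfolding levi_civita_def H_def by blast
    from cov_deriv_metric_quadratic[OF H' this]
    have "?y \<bullet> (H' v *v ?y) = (D c ?x v *v ?y) \<bullet> (H ?x *v ?y) + ?y \<bullet> (H ?x *v (D c ?x v *v ?y))" .
    moreover have "H ?x *v w = - (H ?x *v (D c ?x v *v ?y))"
      using matrix_vector_mult_diff_distrib[of "H ?x" 0 "D c ?x v *v ?y"] by (simp add: w)
    ultimately show ?thesis by (simp add: inner_add_right inner_diff_right w)
  qed
  ultimately show "\<exists>\<phi>'. ((\<lambda>(x, y). y \<bullet> (metric_loc A h c x *v y)) has_derivative \<phi>') (at (?x, ?y)) \<and>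
         (\<forall>v. \<phi>' (v, - (D c ?x v *v ?y)) = 0)"
    by (intro exI[of _ "\<lambda>\<zeta>. ?y \<bullet> (H ?x *v snd \<zeta> + H' (fst \<zeta>) *v ?y) + snd \<zeta> \<bullet> (H ?x *v ?y)"])
       (simp add: H_def case_prod_unfold)
qed

text \<open>The conserved square \<open>h(X, X)\<close> is definite. The time \<open>s\<close> is
  arbitrary for the sake of two uses: from time 0 it gives uniqueness, and towards time 0 it shows
  that a field with nonzero initial value never meets the zero section, where \<open>F\<close> need
  not be smooth.\<close>

lemma parallel_zero:
  assumes h: "riemannian_metric T A h" and D: "levi_civita A h D"
    and \<gamma>: "continuous_map (top_of_set {0..1}) T \<gamma>" and X: "parallel_on A D \<gamma> 0 1 X"
    and t: "t \<in> {0..1}" and s: "s \<in> {0..1}" and X0: "X s = (\<lambda>_. 0)"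
  shows "X t = (\<lambda>_. 0)"
proof (rule ccontr)
  assume "X t \<noteq> (\<lambda>_. 0)"
  moreover have tan: "X t \<in> tangent_space A (\<gamma> t)" "X s \<in> tangent_space A (\<gamma> s)"
    using X t s unfolding parallel_on_def by blast+
  ultimately have "h (\<gamma> t) (X t) (X t) > 0"
    using h curve_in_topspace[OF \<gamma> t] unfolding riemannian_metric_def by blast
  moreover have "h (\<gamma> t) (X t) (X t) = h (\<gamma> s) (X s) (X s)"
    using levi_civita_preserves_metric[OF h D \<gamma> X] t s by metis
  moreover obtain c where c: "c \<in> A" "\<gamma> s \<in> cdom c"
    using curve_in_topspace[OF \<gamma> s] cdom_cover by blast
  ultimately show False
    using metric_loc_eq[OF h c tan(2) tan(2)] by (simp add: X0)
qed

lemma parallel_unique: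
  assumes h: "riemannian_metric T A h" and D: "levi_civita A h D"
    and \<gamma>: "continuous_map (top_of_set {0..1}) T \<gamma>"
    and X: "parallel_on A D \<gamma> 0 1 X" and Y: "parallel_on A D \<gamma> 0 1 Y"
    and eq: "X 0 = Y 0" and t: "t \<in> {0..1}"
  shows "X t = Y t"
proof -
  let ?Z = "\<lambda>t. lin_comb 1 (X t) (- 1) (Y t)"
  have "parallel_on A D \<gamma> 0 1 ?Z" by (rule parallel_on_lin_comb[OF manifold X Y])
  moreover have "?Z 0 = (\<lambda>_. 0)" by (simp add: lin_comb_def eq)
  ultimately have "?Z t = (\<lambda>_. 0)" using parallel_zero[OF h D \<gamma> _ t, of ?Z 0] by simp
  then show ?thesis by (auto simp: lin_comb_def fun_eq_iff)
qed

text \<open>Short intervals are solved by \<open>local_transport\<close>, and bisection passes to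
  the whole curve. Initial and final data are treated together in the relation \<open>R\<close>,
  which is additive over adjacent intervals; the final data later give surjectivity of the
  transport.\<close>

lemma transport_exists:
  assumes D: "linear_connection_TM A D" and \<gamma>: "piecewise_C1_curve T A \<gamma>"
  shows "(\<forall>\<xi>\<in>tangent_space A (\<gamma> 0). \<exists>X. parallel_on A D \<gamma> 0 1 X \<and> X 0 = \<xi>) \<and>
    (\<forall>\<xi>\<in>tangent_space A (\<gamma> 1). \<exists>X. parallel_on A D \<gamma> 0 1 X \<and> X 1 = \<xi>)"
proof -
  have \<gamma>c: "continuous_map (top_of_set {0..1}) T \<gamma>" using \<gamma> by (simp add: piecewise_C1_curve_def)
  obtain S where S: "finite S"
    "\<And>a b. 0 \<le> a \<Longrightarrow> a < b \<Longrightarrow> b \<le> 1 \<Longrightarrow> {a<..<b} \<inter> S = {} \<Longrightarrow> C1_curve_on T A {a..b} \<gamma>"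
    using \<gamma> unfolding piecewise_C1_curve_def by blast
  define R where "R = (\<lambda>a b. (\<forall>\<xi>\<in>tangent_space A (\<gamma> a). \<exists>X. parallel_on A D \<gamma> a b X \<and> X a = \<xi>) \<and>
    (\<forall>\<xi>\<in>tangent_space A (\<gamma> b). \<exists>X. parallel_on A D \<gamma> a b X \<and> X b = \<xi>))"
  have R_trans: "R a c" if ab: "R a b" and bc: "R b c" and le: "a \<le> b" "b \<le> c" for a b c
    unfolding R_def
  proof (intro conjI ballI)
    fix \<xi> assume "\<xi> \<in> tangent_space A (\<gamma> a)"
    then obtain X where X: "parallel_on A D \<gamma> a b X" "X a = \<xi>" using ab unfolding R_def by blast
    have "X b \<in> tangent_space A (\<gamma> b)" using X(1) le unfolding parallel_on_def by auto
    then obtain Y where Y: "parallel_on A D \<gamma> b c Y" "Y b = X b" using bc unfolding R_def by blast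
    show "\<exists>X. parallel_on A D \<gamma> a c X \<and> X a = \<xi>"
      using parallel_on_glue[OF le X(1) Y(1) Y(2)[symmetric]] X(2) le by auto
  next
    fix \<xi> assume "\<xi> \<in> tangent_space A (\<gamma> c)"
    then obtain Y where Y: "parallel_on A D \<gamma> b c Y" "Y c = \<xi>" using bc unfolding R_def by blast
    have "Y b \<in> tangent_space A (\<gamma> b)" using Y(1) le unfolding parallel_on_def by auto
    then obtain X where X: "parallel_on A D \<gamma> a b X" "X b = Y b" using ab unfolding R_def by blast
    have "(if c \<le> b then X c else Y c) = \<xi>" using le X(2) Y(2) by (cases "c = b") auto
    then show "\<exists>X. parallel_on A D \<gamma> a c X \<and> X c = \<xi>"
      using parallel_on_glue[OF le X(1) Y(1) X(2)] by blast
  qed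
  \<comment> \<open>Regularity is assumed only for \<open>p < q\<close>, because the piece on one
    side of a point degenerates when that point is 0 or 1. A degenerate piece carries constant
    fields.\<close>
  have piece: "\<exists>d>0. \<forall>a b. p \<le> a \<longrightarrow> a \<le> b \<longrightarrow> b \<le> q \<longrightarrow> b - a < d \<longrightarrow> R a b"
    if pq: "p < q \<Longrightarrow> C1_curve_on T A {p..q} \<gamma>" and c: "c \<in> A" "\<gamma> ` {p..q} \<subseteq> cdom c" for p q c
  proof (cases "p < q")
    case True
    from local_transport[OF D c(1) pq[OF True] c(2)] obtain d where d: "d > 0"
      "\<And>a b t0 \<xi>. p \<le> a \<Longrightarrow> b \<le> q \<Longrightarrow> b - a < d \<Longrightarrow> t0 \<in> {a..b} \<Longrightarrow>
        \<xi> \<in> tangent_space A (\<gamma> t0) \<Longrightarrow> \<exists>X. parallel_on A D \<gamma> a b X \<and> X t0 = \<xi>" by blast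
    have "R a b" if "p \<le> a" "a \<le> b" "b \<le> q" "b - a < d" for a b
      unfolding R_def using d(2)[of a b a] d(2)[of a b b] that by auto
    then show ?thesis using d(1) by blast
  next
    case False
    have "R a a" for a unfolding R_def using parallel_on_singleton by metis
    then show ?thesis using False by (intro exI[of _ 1]) (auto dest: order_antisym)
  qed
  \<comment> \<open>The guards look trivial at the ends 0 and 1, but they belong to the bisected
    predicate: a small interval around a point near an end may leave \<open>{0..1}\<close>, where
    the curve is not controlled.\<close>
  have "0 \<le> (0::real) \<longrightarrow> (1::real) \<le> 1 \<longrightarrow> R 0 1"
  proof (rule Bolzano[where P = "\<lambda>a b. 0 \<le> a \<longrightarrow> b \<le> 1 \<longrightarrow> R a b"])
    show "0 \<le> a \<longrightarrow> c \<le> 1 \<longrightarrow> R a c"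
      if "0 \<le> a \<longrightarrow> b \<le> 1 \<longrightarrow> R a b" "0 \<le> b \<longrightarrow> c \<le> 1 \<longrightarrow> R b c" "a \<le> b" "b \<le> c" for a b c
      using that R_trans[of a b c] by auto
    fix x :: real assume x: "0 \<le> x" "x \<le> 1"
    then obtain c where c: "c \<in> A" "\<gamma> x \<in> cdom c"
      using curve_in_topspace[OF \<gamma>c, of x] cdom_cover unfolding atLeastAtMost_iff by blast
    obtain U where U: "open U" "{t \<in> {0..1}. \<gamma> t \<in> cdom c} = {0..1} \<inter> U"
      using curve_preimage_open[OF \<gamma>c c(1)] .
    have "x \<in> U" using U(2) c x by auto
    then obtain r where r: "r > 0" "cball x r \<subseteq> U" using U(1) open_contains_cball by blast
    \<comment> \<open>No break point other than possibly \<open>x\<close> lies closer than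
      \<open>r'\<close>. Since \<open>x\<close> may be one itself, the neighbourhood is split at
      \<open>x\<close> and each half is a smooth piece.\<close>
    obtain r' where r': "r' > 0" "\<And>s. s \<in> S \<Longrightarrow> s \<noteq> x \<Longrightarrow> r' \<le> dist x s"
      using finite_set_avoid[OF S(1), of x] by blast
    define m where "m = min r r'"
    define p where "p = max 0 (x - m)"
    define q where "q = min 1 (x + m)"
    have m: "m > 0" using r r' by (simp add: m_def)
    have pq: "0 \<le> p" "p \<le> x" "x \<le> q" "q \<le> 1" using x m by (auto simp: p_def q_def)
    have sub: "\<gamma> ` {p..q} \<subseteq> cdom c"
    proof
      fix z assume "z \<in> \<gamma> ` {p..q}"
      then obtain t where t: "t \<in> {p..q}" "z = \<gamma> t" by blast
      then have "t \<in> cball x r" by (auto simp: p_def q_def m_def dist_real_def)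
      then have "t \<in> {0..1} \<inter> U" using r t pq by auto
      then show "z \<in> cdom c" using U(2) t by blast
    qed
    have avoid: "s \<notin> S" if "s \<in> {p<..<x} \<union> {x<..<q}" for s
      using r'(2)[of s] that by (auto simp: p_def q_def m_def dist_real_def)
    have "\<exists>d>0. \<forall>a b. p \<le> a \<longrightarrow> a \<le> b \<longrightarrow> b \<le> x \<longrightarrow> b - a < d \<longrightarrow> R a b"
      by (rule piece[OF S(2) c(1)]) (use avoid sub pq x in auto)
    then obtain d1 where d1: "d1 > 0" "\<And>a b. p \<le> a \<Longrightarrow> a \<le> b \<Longrightarrow> b \<le> x \<Longrightarrow> b - a < d1 \<Longrightarrow> R a b"
      by blast
    have "\<exists>d>0. \<forall>a b. x \<le> a \<longrightarrow> a \<le> b \<longrightarrow> b \<le> q \<longrightarrow> b - a < d \<longrightarrow> R a b"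
      by (rule piece[OF S(2) c(1)]) (use avoid sub pq x in auto)
    then obtain d2 where d2: "d2 > 0" "\<And>a b. x \<le> a \<Longrightarrow> a \<le> b \<Longrightarrow> b \<le> q \<Longrightarrow> b - a < d2 \<Longrightarrow> R a b"
      by blast
    show "\<exists>d>0. \<forall>a b. a \<le> x \<and> x \<le> b \<and> b - a < d \<longrightarrow> 0 \<le> a \<longrightarrow> b \<le> 1 \<longrightarrow> R a b"
    \<comment> \<open>The bound \<open>m\<close> keeps the interval within \<open>{p..q}\<close>,
      while \<open>d1\<close> and \<open>d2\<close> make its two halves short enough to be
      solvable.\<close>
    proof (intro exI[of _ "min m (min d1 d2)"] conjI allI impI)
      show "0 < min m (min d1 d2)" using m d1 d2 by simp
      fix a b assume ab: "a \<le> x \<and> x \<le> b \<and> b - a < min m (min d1 d2)" "0 \<le> a" "b \<le> 1"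
      then have "R a x" using pq by (intro d1(2)) (auto simp: p_def)
      moreover have "R x b" using ab pq by (intro d2(2)) (auto simp: q_def)
      ultimately show "R a b" using R_trans ab by blast
    qed
  qed simp
  then show ?thesis unfolding R_def by simp
qed

section \<open>The Levi-Civita connection and the Finsler function of a Berwald space\<close>

lemma finsler_loc_local:
  assumes F: "finsler_structure T A F" and c: "c \<in> A"
  shows "local_finsler (cimg c) (finsler_loc A F c)"
proof
  show "open (cimg c)" by (rule open_cimg[OF c])
  show "smooth_on (cimg c \<times> - {0}) (\<lambda>(x, y). finsler_loc A F c x y)"
    using F c unfolding finsler_structure_def slit_img_def by blast
  show "v \<bullet> (fund (finsler_loc A F c) x y *v v) > 0" if "x \<in> cimg c" "y \<noteq> 0" "v \<noteq> 0" for x y v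
  proof -
    have "(x, y) \<in> slit_img c" using that by (simp add: slit_img_def)
    then show ?thesis using F c that unfolding finsler_structure_def by blast
  qed
  fix x y :: "real^'n" and a :: real assume x: "x \<in> cimg c" and a: "a > 0"
  have p: "cinv c x \<in> cdom c" "cinv c x \<in> topspace T" using x c cinv_in_topspace by auto
  have "vec_at A c x y \<in> tangent_space A (cinv c x)" using vec_at_tangent[OF c p(1)] x by simp
  then have "F (cinv c x) (scale_tvec a (vec_at A c x y)) = a * F (cinv c x) (vec_at A c x y)"
    using F p(2) a unfolding finsler_structure_def by blast
  then show "finsler_loc A F c x (a *\<^sub>R y) = a * finsler_loc A F c x y"
    by (simp add: finsler_loc_def vec_at_scale)
qed

text \<open>The comparison by \<open>metric_connection_unique\<close> is made at one fixed nonzero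
  \<open>y\<close>. This \<open>y\<close> is arbitrary, so the components of a parallel vector can
  later be inserted for it, as \<open>horizontal_derivative_zero\<close> demands.\<close>

lemma berwald_levi_civita_eq_chern:
  assumes F: "finsler_structure T A F" and chern: "chern_connection A F \<omega>"
    and basic: "\<forall>c\<in>A. \<forall>x\<in>cimg c. \<forall>y y' i j k. y \<noteq> 0 \<longrightarrow> y' \<noteq> 0 \<longrightarrow>
           conn_coeff (\<omega> c) x y i j k = conn_coeff (\<omega> c) x y' i j k"
    and h: "riemannian_metric T A h"
    and par: "parallel_pullback_metric A (berwald_connection A F) h"
    and D: "levi_civita A h D" and c: "c \<in> A" and x: "x \<in> cimg c" and y: "y \<noteq> 0"
  shows "D c x u = \<omega> c (x, y) (u, 0)"
proof -
  define L where "L = finsler_loc A F c"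
  interpret local_finsler "cimg c" L unfolding L_def by (rule finsler_loc_local[OF F c])
  define W where "W = (\<lambda>u. \<omega> c (x, y) (u, 0))"
  have \<omega>: "linear (\<omega> c (x, y'))" "torsion_free_at fst (\<omega> c) (x, y')"
    "\<And>\<zeta> i j. cov_deriv_metric (\<omega> c) (\<lambda>(x, y). fund L x y) (x, y') \<zeta> i j =
             2 * (\<Sum>k\<in>UNIV. cartan L x y' i j k * (delta_y L x y' k \<zeta> / L x y'))"
    if "y' \<noteq> 0" for y'
  proof -
    have z: "(x, y') \<in> slit_img c" using x that by (simp add: slit_img_def)
    show "linear (\<omega> c (x, y'))"
      using chern c z unfolding chern_connection_def linear_connection_pullback_def smooth_conn_form_def
      by blast
    have "torsion_free_at fst (\<omega> c) (x, y') \<and>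
          (\<forall>\<zeta> i j. cov_deriv_metric (\<omega> c) (\<lambda>(x, y). fund L x y) (x, y') \<zeta> i j =
             2 * (\<Sum>k\<in>UNIV. cartan L x y' i j k * (delta_y L x y' k \<zeta> / L x y')))"
      using chern c z unfolding chern_connection_def L_def Let_def by blast
    then show "torsion_free_at fst (\<omega> c) (x, y')"
      "\<And>\<zeta> i j. cov_deriv_metric (\<omega> c) (\<lambda>(x, y). fund L x y) (x, y') \<zeta> i j =
             2 * (\<Sum>k\<in>UNIV. cartan L x y' i j k * (delta_y L x y' k \<zeta> / L x y'))" by blast+
  qed
  have linW: "linear W"
    unfolding W_def using linear_compose[of "\<lambda>u. (u, 0)" "\<omega> c (x, y)"] \<omega>(1)[OF y]
    by (simp add: comp_def linear_iff)
  have W: "W u $ i $ j = (\<Sum>k\<in>UNIV. conn_coeff (\<omega> c) x y i j k * u $ k)" for u i j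
    using linear_sum_axis[OF linW, of u] by (simp add: W_def conn_coeff_def mult.commute)
  have bc: "berwald_connection A F c (x, y) (u, v) = W u" for u v
  proof -
    have "partial k (\<lambda>y'. nonlin_conn L x y' i j) y = conn_coeff (\<omega> c) x y i j k" for i j k
    proof -
      have "((\<lambda>y'. \<Sum>k\<in>UNIV. conn_coeff (\<omega> c) x y i j k * y' $ k) has_derivative
          (\<lambda>v. \<Sum>k\<in>UNIV. conn_coeff (\<omega> c) x y i j k * v $ k)) (at y)"
        by (auto intro!: derivative_eq_intros bounded_linear.has_derivative[OF bounded_linear_vec_nth])
      then have "((\<lambda>y'. nonlin_conn L x y' i j) has_derivative
          (\<lambda>v. \<Sum>k\<in>UNIV. conn_coeff (\<omega> c) x y i j k * v $ k)) (at y)"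
      proof (rule has_derivative_transform_within_open)
        show "open (- {0 :: real^'n})" "y \<in> - {0}" using y by auto
        fix y' :: "real^'n" assume "y' \<in> -{0}"
        then have y': "y' \<noteq> 0" by simp
        \<comment> \<open>Here the Berwald condition enters: coefficients at \<open>y'\<close> are
          frozen at \<open>y\<close>, so \<open>N\<close> is linear in \<open>y'\<close> and its
          vertical derivative is the coefficient itself.\<close>
        have "conn_coeff (\<omega> c) x y' i j k = conn_coeff (\<omega> c) x y i j k" for k
          using basic c x y y' by blast
        then show "(\<Sum>k\<in>UNIV. conn_coeff (\<omega> c) x y i j k * y' $ k) = nonlin_conn L x y' i j"
          using nonlin_conn_eq[of x y' "\<omega> c", OF _ \<omega>[OF y']] x y' by simp
      qed
      from partial_eq[OF this] show ?thesis
        by (simp add: axis_def if_distrib[of "\<lambda>x. _ * x"] cong: if_cong)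
    qed
    then show ?thesis by (simp add: berwald_connection_def vec_eq_iff W L_def[symmetric])
  qed
  define H where "H = metric_loc A h c"
  have H': "(H has_derivative frechet_derivative H (at x)) (at x)"
    using smooth_on_has_derivative[OF _ x] h c unfolding riemannian_metric_def H_def by blast
  have HD: "((\<lambda>x. H x $ i $ j) has_derivative (\<lambda>u. frechet_derivative H (at x) u $ i $ j)) (at x)" for i j
    by (intro bounded_linear.has_derivative[OF bounded_linear_vec_nth] H')
  have "W = D c x"
  proof (rule metric_connection_unique)
    show "linear W" by (rule linW)
    show "linear (D c x)"
      using D c x unfolding levi_civita_def linear_connection_TM_def smooth_conn_form_def by blast
    show "H x $ i $ j = H x $ j $ i" for i j unfolding H_def by (rule metric_loc_sym[OF h c x])
    show "v \<bullet> (H x *v v) > 0" if "v \<noteq> 0" for v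
      unfolding H_def by (rule metric_loc_pos[OF h c x that])
    show "W (axis k 1) $ i $ j = W (axis j 1) $ i $ k" for i j k
      unfolding W_def by (rule torsion_free_at_fst(2)[OF \<omega>(1,2)[OF y]])
    show "D c x (axis k 1) $ i $ j = D c x (axis j 1) $ i $ k" for i j k
    proof -
      have "torsion_free_at id (D c) x" using D c x unfolding levi_civita_def by blast
      then have "(\<Sum>l\<in>UNIV. axis j 1 $ l * D c x (axis k 1) $ i $ l - axis k 1 $ l * D c x (axis j 1) $ i $ l) = 0"
        unfolding torsion_free_at_def id_def by blast
      then show ?thesis
        by (simp add: sum_subtractf axis_def if_distrib[of "\<lambda>x. x * _"] cong: if_cong)
    qed
    fix u i j
    have "cov_deriv_metric (D c) H x u i j = 0"
      using D c x unfolding levi_civita_def H_def by blast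
    moreover have "cov_deriv_metric (berwald_connection A F c) (pullback_metric A h c) (x, y) (u, 0) i j = 0"
      using par c x y unfolding parallel_pullback_metric_def slit_img_def by simp
    \<comment> \<open>The fibre metric does not depend on \<open>y\<close>, so its derivative along
      \<open>(u, 0)\<close> is the derivative of \<open>H\<close> on the base, and the two
      compatibility conditions can be equated.\<close>
    moreover have "frechet_derivative (\<lambda>z. pullback_metric A h c z $ i $ j) (at (x, y)) (u, 0)
        = frechet_derivative (\<lambda>x. H x $ i $ j) (at x) u"
    proof -
      have "((\<lambda>z. H (fst z) $ i $ j) has_derivative (\<lambda>\<zeta>. frechet_derivative H (at x) (fst \<zeta>) $ i $ j)) (at (x, y))"
        by (rule has_derivative_compose[where g = "\<lambda>x. H x $ i $ j" and f = fst])
           (auto intro!: derivative_eq_intros HD)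
      from frechet_derivative_eq[OF this] frechet_derivative_eq[OF HD] show ?thesis
        by (simp add: pullback_metric_def H_def case_prod_unfold)
    qed
    ultimately show "(\<Sum>k\<in>UNIV. H x $ k $ j * W u $ k $ i) + (\<Sum>k\<in>UNIV. H x $ i $ k * W u $ k $ j) =
      (\<Sum>k\<in>UNIV. H x $ k $ j * D c x u $ k $ i) + (\<Sum>k\<in>UNIV. H x $ i $ k * D c x u $ k $ j)"
      by (simp add: cov_deriv_metric_def bc pullback_metric_def H_def)
  qed
  from fun_cong[OF this, of u] show ?thesis by (simp add: W_def)
qed

text \<open>Homogeneity with factor 2 gives \<open>F = 2 F\<close> at the zero vector. This settles
  the one case that differentiation cannot reach.\<close>

lemma finsler_zero:
  assumes F: "finsler_structure T A F" and p: "p \<in> topspace T"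
  shows "F p (\<lambda>_. 0) = 0"
proof -
  have "(\<lambda>_. 0) \<in> tangent_space A p" unfolding tangent_space_def by simp
  then have "F p (scale_tvec 2 (\<lambda>_. 0)) = 2 * F p (\<lambda>_. 0)"
    using F p unfolding finsler_structure_def by simp
  then show ?thesis by (simp add: scale_tvec_def)
qed

lemma berwald_transport_preserves_finsler:
  assumes F: "berwald_structure T A F" and h: "riemannian_metric T A h"
    and par: "parallel_pullback_metric A (berwald_connection A F) h"
    and D: "levi_civita A h D" and \<gamma>: "continuous_map (top_of_set {0..1}) T \<gamma>"
    and X: "parallel_on A D \<gamma> 0 1 X"
  shows "F (\<gamma> 1) (X 1) = F (\<gamma> 0) (X 0)"
proof -
  have fs: "finsler_structure T A F" using F by (simp add: berwald_structure_def)
  obtain \<omega> where \<omega>: "chern_connection A F \<omega>"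
    "\<forall>c\<in>A. \<forall>x\<in>cimg c. \<forall>y y' i j k. y \<noteq> 0 \<longrightarrow> y' \<noteq> 0 \<longrightarrow>
           conn_coeff (\<omega> c) x y i j k = conn_coeff (\<omega> c) x y' i j k"
    using F unfolding berwald_structure_def by blast
  show ?thesis
  proof (cases "X 0 = (\<lambda>_. 0)")
    case True
    then have "X 1 = (\<lambda>_. 0)" using parallel_zero[OF h D \<gamma> X, of 1 0] by simp
    then show ?thesis using True finsler_zero[OF fs] curve_in_topspace[OF \<gamma>] by simp
  next
    case False
    show ?thesis
    proof (rule parallel_constant[OF \<gamma> X, where \<phi> = "\<lambda>c (x, y). finsler_loc A F c x y"])
      fix c t assume c: "c \<in> A" and t: "t \<in> {0..1}" and p: "\<gamma> t \<in> cdom c"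
      have Xt: "X t \<in> tangent_space A (\<gamma> t)" using X t unfolding parallel_on_def by blast
      show "F (\<gamma> t) (X t) = (case (cmap c (\<gamma> t), X t c) of (x, y) \<Rightarrow> finsler_loc A F c x y)"
        using tangent_eq_vec_at[OF c p Xt] c p by (simp add: finsler_loc_def)
      let ?x = "cmap c (\<gamma> t)" and ?y = "X t c"
      have x: "?x \<in> cimg c" using p by simp
      \<comment> \<open>\<open>parallel_zero\<close> is applied backwards in time: a zero at
        \<open>t\<close> would force a zero at time 0.\<close>
      have "X t \<noteq> (\<lambda>_. 0)"
        using parallel_zero[OF h D \<gamma> X, of 0 t] t False by auto
      then have y: "?y \<noteq> 0" using tangent_zero_iff[OF c p Xt] by simp
      interpret local_finsler "cimg c" "finsler_loc A F c" by (rule finsler_loc_local[OF fs c])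
      have z: "(?x, ?y) \<in> cimg c \<times> - {0}" "(?x, ?y) \<in> slit_img c" using x y by (auto simp: slit_img_def)
      have "cov_deriv_metric (\<omega> c) (\<lambda>(x, y). fund (finsler_loc A F c) x y) (?x, ?y) \<zeta> i j =
             2 * (\<Sum>k\<in>UNIV. cartan (finsler_loc A F c) ?x ?y i j k *
               (delta_y (finsler_loc A F c) ?x ?y k \<zeta> / finsler_loc A F c ?x ?y))" for \<zeta> i j
        using \<omega>(1) c z(2) unfolding chern_connection_def Let_def by blast
      from horizontal_derivative_zero[OF z(1) this]
      have "frechet_derivative (\<lambda>(x, y). finsler_loc A F c x y) (at (?x, ?y)) (v, - (D c ?x v *v ?y)) = 0" for v
        using berwald_levi_civita_eq_chern[OF fs \<omega> h par D c x y] by simp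
      then show "\<exists>\<phi>'. ((\<lambda>(x, y). finsler_loc A F c x y) has_derivative \<phi>') (at (?x, ?y)) \<and>
         (\<forall>v. \<phi>' (v, - (D c ?x v *v ?y)) = 0)"
        using smooth_on_has_derivative[OF smoothL z(1)] by blast
    qed simp
  qed
qed

end

theorem proposition3p6:
  fixes T :: "'a topology" and A :: "('a, 'n::finite) chart set"
    and F :: "('a, 'n) finsler" and h :: "('a, 'n) metric"
    and D :: "('a, 'n) chart \<Rightarrow> (real^'n, 'n) conn_form"
  assumes "smooth_manifold T A"
    and "berwald_structure T A F"
    and "riemannian_metric T A h"
    and "parallel_pullback_metric A (berwald_connection A F) h"
    and "levi_civita A h D"
  shows "leaves_indicatrix_invariant T A D F"
  unfolding leaves_indicatrix_invariant_def
proof (intro allI impI)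
  interpret smooth_atlas T A by standard fact
  fix \<gamma> assume \<gamma>: "piecewise_C1_curve T A \<gamma>"
  then have \<gamma>c: "continuous_map (top_of_set {0..1}) T \<gamma>" by (simp add: piecewise_C1_curve_def)
  have "linear_connection_TM A D" using assms(5) by (simp add: levi_civita_def)
  note ex = transport_exists[OF this \<gamma>]
  have preserve: "F (\<gamma> 1) (X 1) = F (\<gamma> 0) (X 0)" if "parallel_on A D \<gamma> 0 1 X" for X
    by (rule berwald_transport_preserves_finsler[OF assms(2-5) \<gamma>c that])
  have tan: "X 0 \<in> tangent_space A (\<gamma> 0)" "X 1 \<in> tangent_space A (\<gamma> 1)"
    if "parallel_on A D \<gamma> 0 1 X" for X
    using that unfolding parallel_on_def by simp_all
  \<comment> \<open>The definite description is resolved: \<open>X\<close> itself is a witness, and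
    uniqueness of parallel fields makes its end value the only candidate.\<close>
  have transport: "parallel_transport A D \<gamma> (X 0) = X 1" if X: "parallel_on A D \<gamma> 0 1 X" for X
    unfolding parallel_transport_def parallel_along_iff
  proof (rule the_equality)
    show "\<exists>Y. parallel_on A D \<gamma> 0 1 Y \<and> Y 0 = X 0 \<and> Y 1 = X 1" using X by blast
    fix \<eta> assume "\<exists>Y. parallel_on A D \<gamma> 0 1 Y \<and> Y 0 = X 0 \<and> Y 1 = \<eta>"
    then show "\<eta> = X 1" using parallel_unique[OF assms(3,5) \<gamma>c _ X, of _ 1] by auto
  qed
  show "parallel_transport A D \<gamma> ` indicatrix A F (\<gamma> 0) = indicatrix A F (\<gamma> 1)"
  proof (intro equalityI subsetI)
    fix \<eta> assume "\<eta> \<in> parallel_transport A D \<gamma> ` indicatrix A F (\<gamma> 0)"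
    then obtain \<xi> where \<xi>: "\<xi> \<in> tangent_space A (\<gamma> 0)" "F (\<gamma> 0) \<xi> = 1"
      "\<eta> = parallel_transport A D \<gamma> \<xi>" unfolding indicatrix_def by blast
    obtain X where X: "parallel_on A D \<gamma> 0 1 X" "X 0 = \<xi>" using ex \<xi>(1) by blast
    then show "\<eta> \<in> indicatrix A F (\<gamma> 1)"
      using transport[OF X(1)] preserve[OF X(1)] tan(2)[OF X(1)] \<xi> by (simp add: indicatrix_def)
  next
    fix \<eta> assume \<eta>: "\<eta> \<in> indicatrix A F (\<gamma> 1)"
    \<comment> \<open>Surjectivity: the field is prescribed at the final end, and its initial value
      is the preimage.\<close>
    then obtain X where X: "parallel_on A D \<gamma> 0 1 X" "X 1 = \<eta>"
      using ex unfolding indicatrix_def by blast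
    then have "X 0 \<in> indicatrix A F (\<gamma> 0)"
      using preserve[OF X(1)] tan(1)[OF X(1)] \<eta> by (simp add: indicatrix_def)
    then show "\<eta> \<in> parallel_transport A D \<gamma> ` indicatrix A F (\<gamma> 0)"
      using transport[OF X(1)] X(2) by (metis imageI)
  qed
qed

end
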